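(* Let $H$ be a Hénon map of degree $d\geq2$ and let $G_H^+$ be its Green's function. Then for every $r>0$ the sublevel set \[ \Omega_r=\{(z,w)\in\mathbb{C}^2: G_H^+(z,w)<r\} \] is a Loewner Short $\mathbb{C}^2$.
   Context: A Hénon map is a map $H(z,w)=(p(z)+\delta w,\ z)$ of $\mathbb{C}^2$ where $p$ is a polynomial of degree $d\geq2$ and $\delta\neq0$. Its Green's function is $G_H^+(z,w)=\lim_{n\to\infty}\frac{1}{d^n}\log^+\|H^n(z,w)\|$, where $\log^+x=\max\{\log x,0\}$ and $H^n$ is the $n$-th iterate. Definition (Short $\mathbb{C}^k$): for $k\geq 2$, a domain $\Omega\subseteq\mathbb{C}^k$ is a Short $\mathbb{C}^k$ if it is the union of an increasing sequence of domains each biholomorphic to the unit ball of $\mathbb{C}^k$, its Kobayashi–Royden infinitesimal pseudometric vanishes identically, and it carries a non-constant plurisubharmonic function bounded above. Definition (Loewner): a Short $\mathbb{C}^k$ $\Omega$ is Loewner if there is a family of domains $\{\Omega_t\}_{t\geq0}$ with: (1) $\Omega=\bigcup_{t\geq0}\Omega_t$, and either every $\Omega_t$ is biholomorphic to the unit ball of $\mathbb{C}^k$ or every $\Omega_t$ is biholomorphic to the unit polydisc of $\mathbb{C}^k$; (2) $\Omega_t\subset\subset\Omega_s$ whenever $0\leq t<s$; (3) $\Omega_t=\bigcup_{t'<t}\Omega_{t'}$ for all $t>0$; (4) $\overline{\Omega_{t'}}=\bigcap_{t>t'}\Omega_t$ for all $t'\geq 0$. *)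

theory Defs
  imports "HOL-Complex_Analysis.Complex_Analysis" "HOL-Computational_Algebra.Polynomial"
begin

text \<open>We model C^2 as the product type complex \<times> complex; its norm is the Euclidean norm.\<close>
type_synonym c2 = "complex \<times> complex"

definition cscale :: "complex \<Rightarrow> c2 \<Rightarrow> c2" (infixr "*\<^sub>C" 75) where
  "c *\<^sub>C v = (c * fst v, c * snd v)"

definition henon :: "complex poly \<Rightarrow> complex \<Rightarrow> c2 \<Rightarrow> c2" where
  "henon p \<delta> = (\<lambda>(z, w). (poly p z + \<delta> * w, z))"

definition log_plus :: "real \<Rightarrow> real" where
  "log_plus x = max (ln x) 0"

definition green_plus :: "(c2 \<Rightarrow> c2) \<Rightarrow> nat \<Rightarrow> c2 \<Rightarrow> real" where
  "green_plus H d x = lim (\<lambda>n. log_plus (norm ((H ^^ n) x)) / real d ^ n)"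

definition c2_domain :: "c2 set \<Rightarrow> bool" where
  "c2_domain S \<longleftrightarrow> open S \<and> connected S \<and> S \<noteq> {}"

definition c2_holomorphic_on :: "(c2 \<Rightarrow> c2) \<Rightarrow> c2 set \<Rightarrow> bool" where
  "c2_holomorphic_on f S \<longleftrightarrow>
     (\<forall>x\<in>S. \<exists>D. (f has_derivative D) (at x) \<and> (\<forall>c v. D (c *\<^sub>C v) = c *\<^sub>C D v))"

definition biholomorphic :: "c2 set \<Rightarrow> c2 set \<Rightarrow> bool" where
  "biholomorphic U V \<longleftrightarrow> open U \<and> open V \<and>
     (\<exists>f g. c2_holomorphic_on f U \<and> c2_holomorphic_on g V \<and> f ` U \<subseteq> V \<and> g ` V \<subseteq> U \<and>
            (\<forall>x\<in>U. g (f x) = x) \<and> (\<forall>y\<in>V. f (g y) = y))"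

definition unit_ball2 :: "c2 set" where
  "unit_ball2 = ball 0 1"

definition unit_polydisc2 :: "c2 set" where
  "unit_polydisc2 = {(z, w). cmod z < 1 \<and> cmod w < 1}"

definition disc_holomorphic :: "(complex \<Rightarrow> c2) \<Rightarrow> bool" where
  "disc_holomorphic f \<longleftrightarrow>
     (\<lambda>\<zeta>. fst (f \<zeta>)) holomorphic_on ball 0 1 \<and> (\<lambda>\<zeta>. snd (f \<zeta>)) holomorphic_on ball 0 1"

definition disc_deriv0 :: "(complex \<Rightarrow> c2) \<Rightarrow> c2" where
  "disc_deriv0 f = (deriv (\<lambda>\<zeta>. fst (f \<zeta>)) 0, deriv (\<lambda>\<zeta>. snd (f \<zeta>)) 0)"

definition kobayashi_royden :: "c2 set \<Rightarrow> c2 \<Rightarrow> c2 \<Rightarrow> real" where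
  "kobayashi_royden \<Omega> x v = Inf {\<alpha>::real. \<alpha> > 0 \<and>
      (\<exists>f. disc_holomorphic f \<and> f ` ball 0 1 \<subseteq> \<Omega> \<and> f 0 = x \<and> \<alpha> *\<^sub>R disc_deriv0 f = v)}"

definition circle_mean :: "(c2 \<Rightarrow> ereal) \<Rightarrow> c2 \<Rightarrow> c2 \<Rightarrow> real \<Rightarrow> ereal" where
  "circle_mean u a b r = ereal (1 / (2 * pi)) *
     (enn2ereal (\<integral>\<^sup>+ \<theta>. e2ennreal (u (a + (complex_of_real r * exp (\<i> * complex_of_real \<theta>)) *\<^sub>C b))
                     * indicator {0..2*pi} \<theta> \<partial>lborel)
      - enn2ereal (\<integral>\<^sup>+ \<theta>. e2ennreal (- u (a + (complex_of_real r * exp (\<i> * complex_of_real \<theta>)) *\<^sub>C b))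
                     * indicator {0..2*pi} \<theta> \<partial>lborel))"

definition plurisubharmonic_on :: "c2 set \<Rightarrow> (c2 \<Rightarrow> ereal) \<Rightarrow> bool" where
  "plurisubharmonic_on \<Omega> u \<longleftrightarrow>
     (\<forall>x\<in>\<Omega>. u x \<noteq> \<infinity>) \<and>
     (\<forall>c. open {x\<in>\<Omega>. u x < c}) \<and>
     (\<forall>a b r. r > 0 \<longrightarrow> (\<forall>\<zeta>. cmod \<zeta> \<le> r \<longrightarrow> a + \<zeta> *\<^sub>C b \<in> \<Omega>) \<longrightarrow> u a \<le> circle_mean u a b r)"

definition short_C2 :: "c2 set \<Rightarrow> bool" where
  "short_C2 \<Omega> \<longleftrightarrow> c2_domain \<Omega> \<and>
     (\<exists>D :: nat \<Rightarrow> c2 set. (\<forall>n. D n \<subseteq> D (Suc n)) \<and> (\<forall>n. c2_domain (D n) \<and> biholomorphic (D n) unit_ball2)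
        \<and> (\<Union>n. D n) = \<Omega>) \<and>
     (\<forall>x\<in>\<Omega>. \<forall>v. kobayashi_royden \<Omega> x v = 0) \<and>
     (\<exists>u. plurisubharmonic_on \<Omega> u \<and> (\<exists>M::real. \<forall>x\<in>\<Omega>. u x \<le> ereal M) \<and>
          (\<exists>x\<in>\<Omega>. \<exists>y\<in>\<Omega>. u x \<noteq> u y))"

definition rel_compact_in :: "c2 set \<Rightarrow> c2 set \<Rightarrow> bool" where
  "rel_compact_in A B \<longleftrightarrow> compact (closure A) \<and> closure A \<subseteq> B"

definition loewner_short_C2 :: "c2 set \<Rightarrow> bool" where
  "loewner_short_C2 \<Omega> \<longleftrightarrow> short_C2 \<Omega> \<and>
     (\<exists>F :: real \<Rightarrow> c2 set.
        (\<Union>t\<in>{0..}. F t) = \<Omega> \<and>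
        (\<forall>t\<ge>0. c2_domain (F t)) \<and>
        ((\<forall>t\<ge>0. biholomorphic (F t) unit_ball2) \<or> (\<forall>t\<ge>0. biholomorphic (F t) unit_polydisc2)) \<and>
        (\<forall>t s. 0 \<le> t \<and> t < s \<longrightarrow> rel_compact_in (F t) (F s)) \<and>
        (\<forall>t>0. F t = (\<Union>t'\<in>{0..<t}. F t')) \<and>
        (\<forall>t'\<ge>0. closure (F t') = (\<Inter>t\<in>{t'<..}. F t)))"

end

theory Submission
  imports Defs
begin

text \<open>Let \<open>G\<close> be the Green's function. If \<open>K\<close> bounds the growth of \<open>H\<close> in the sense that
  \<open>max 1 |H x| \<le> K * (max 1 |x|) ^ d\<close>, then \<open>(ln (max 1 |(H ^^ n) x|) + ln K) / d ^ n\<close> decreases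
  to \<open>G x\<close>. Hence \<open>G\<close> is plurisubharmonic, and \<open>{G < r}\<close> is the increasing union of the preimages
  under \<open>H ^^ n\<close> of the balls of radius \<open>exp (d ^ n * r) / K\<close>. If \<open>G x < s < r\<close>, Cauchy's estimate
  bounds the derivative of \<open>H ^^ n\<close> at \<open>x\<close> by a multiple of \<open>exp (d ^ n * s)\<close>, so pulling back affine
  discs in these balls gives discs with arbitrarily large derivative and the Kobayashi metric vanishes.

  For the Loewner property, polydiscs with radii \<open>a\<^sub>N = exp (d ^ N * r) / Q\<close> are used instead. The shears
  \<open>(z, w) \<mapsto> (z, \<delta> w + s p(z))\<close> with \<open>0 \<le> s \<le> 1\<close> connect the polydisc
  \<open>{|z| < a\<^bsub>N+1\<^esub>, |w| < 2 a\<^sub>N}\<close> to the preimage under \<open>H\<close> of the next such polydisc, and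
  \<open>a\<^bsub>N+2\<^esub>\<close> is so large that the second radius can be increased fast enough to make this family
  increasing.\<close>

section \<open>Holomorphic maps and automorphisms of the plane\<close>

lemma cscale_simps [simp]:
  "fst (c *\<^sub>C v) = c * fst v" "snd (c *\<^sub>C v) = c * snd v"
  by (simp_all add: cscale_def)

lemma cscale_zero_left [simp]: "0 *\<^sub>C v = 0"
  by (simp add: cscale_def zero_prod_def)

lemma norm_cscale: "norm (c *\<^sub>C v) = cmod c * norm v"
  by (simp add: norm_prod_def norm_mult power_mult_distrib distrib_left[symmetric] real_sqrt_mult)

lemma scaleR_eq_cscale: "r *\<^sub>R v = complex_of_real r *\<^sub>C v"
  by (auto simp: cscale_def prod_eq_iff scaleR_conv_of_real)

lemma norm_c2_le: "norm (x :: c2) \<le> cmod (fst x) + cmod (snd x)"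
  using norm_Pair_le[of "fst x" "snd x"] by simp

lemma bounded_linear_cscale_left: "bounded_linear (\<lambda>c. c *\<^sub>C v)"
  unfolding cscale_def by (intro bounded_linear_Pair bounded_linear_mult_left)

lemma continuous_on_cscale [continuous_intros]:
  "continuous_on S f \<Longrightarrow> continuous_on S (\<lambda>t. f t *\<^sub>C v)"
  unfolding cscale_def by (intro continuous_intros)

lemma c2_holomorphic_imp_continuous:
  "c2_holomorphic_on f S \<Longrightarrow> continuous_on S f"
  unfolding c2_holomorphic_on_def
  by (metis continuous_at_imp_continuous_on has_derivative_continuous)

lemma c2_holomorphic_on_subset:
  "c2_holomorphic_on f S \<Longrightarrow> T \<subseteq> S \<Longrightarrow> c2_holomorphic_on f T"
  unfolding c2_holomorphic_on_def by blast

lemma c2_holomorphic_on_comp: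
  assumes "c2_holomorphic_on f UNIV" "c2_holomorphic_on g UNIV"
  shows "c2_holomorphic_on (\<lambda>x. g (f x)) UNIV"
  unfolding c2_holomorphic_on_def
proof
  fix x
  obtain D where D: "(f has_derivative D) (at x)" "\<forall>c v. D (c *\<^sub>C v) = c *\<^sub>C D v"
    using assms(1) unfolding c2_holomorphic_on_def by blast
  obtain E where E: "(g has_derivative E) (at (f x))" "\<forall>c v. E (c *\<^sub>C v) = c *\<^sub>C E v"
    using assms(2) unfolding c2_holomorphic_on_def by blast
  have "((\<lambda>x. g (f x)) has_derivative (\<lambda>v. E (D v))) (at x)"
    using has_derivative_compose[OF D(1) E(1)] .
  then show "\<exists>D. ((\<lambda>x. g (f x)) has_derivative D) (at x) \<and> (\<forall>c v. D (c *\<^sub>C v) = c *\<^sub>C D v)"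
    using D(2) E(2) by (intro exI[of _ "\<lambda>v. E (D v)"]) (simp del: split_paired_All)
qed

lemma has_derivative_poly_comp:
  fixes f :: "c2 \<Rightarrow> complex"
  assumes "(f has_derivative D) (at x)"
  shows "((\<lambda>x. poly q (f x)) has_derivative (\<lambda>v. poly (pderiv q) (f x) * D v)) (at x)"
  using has_derivative_compose[OF assms poly_DERIV[of q "f x", unfolded has_field_derivative_def]] .

text \<open>The identity, scalings, shears, the Henon map and its inverse all have this form, so one
  derivative computation covers them all.\<close>

lemma c2_holomorphic_on_poly_sums:
  "c2_holomorphic_on (\<lambda>x. (poly q1 (fst x) + poly q2 (snd x), poly q3 (fst x) + poly q4 (snd x))) UNIV"
  unfolding c2_holomorphic_on_def
proof
  fix x :: c2
  have f: "((fst :: c2 \<Rightarrow> complex) has_derivative fst) (at x)"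
    and s: "((snd :: c2 \<Rightarrow> complex) has_derivative snd) (at x)"
    by (auto intro!: derivative_eq_intros)
  let ?D = "\<lambda>v. (poly (pderiv q1) (fst x) * fst v + poly (pderiv q2) (snd x) * snd v,
                  poly (pderiv q3) (fst x) * fst v + poly (pderiv q4) (snd x) * snd v)"
  have "((\<lambda>x. (poly q1 (fst x) + poly q2 (snd x), poly q3 (fst x) + poly q4 (snd x)))
       has_derivative ?D) (at x)"
    by (intro has_derivative_Pair has_derivative_add has_derivative_poly_comp[OF f] has_derivative_poly_comp[OF s])
  moreover have "\<forall>c v. ?D (c *\<^sub>C v) = c *\<^sub>C ?D v"
    by (simp add: cscale_def algebra_simps)
  ultimately show "\<exists>D. ((\<lambda>x. (poly q1 (fst x) + poly q2 (snd x), poly q3 (fst x) + poly q4 (snd x)))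
       has_derivative D) (at x) \<and> (\<forall>c v. D (c *\<^sub>C v) = c *\<^sub>C D v)"
    by blast
qed

text \<open>The chain rule along a complex line. It yields one-variable derivatives with known
  values, as needed for Cauchy's estimate and for \<open>disc_deriv0\<close>.\<close>

lemma c2_holomorphic_on_line:
  assumes "(f has_derivative D) (at (x + \<zeta> *\<^sub>C v))" "\<forall>c v. D (c *\<^sub>C v) = c *\<^sub>C D v"
  shows "((\<lambda>\<zeta>. fst (f (x + \<zeta> *\<^sub>C v))) has_field_derivative fst (D v)) (at \<zeta>)"
    and "((\<lambda>\<zeta>. snd (f (x + \<zeta> *\<^sub>C v))) has_field_derivative snd (D v)) (at \<zeta>)"
proof -
  have "((\<lambda>\<zeta>. x + \<zeta> *\<^sub>C v) has_derivative (\<lambda>h. h *\<^sub>C v)) (at \<zeta>)"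
    using has_derivative_add[OF has_derivative_const[of x]
        bounded_linear_imp_has_derivative[OF bounded_linear_cscale_left[of v]]] by simp
  from has_derivative_compose[OF this assms(1)]
  have *: "((\<lambda>\<zeta>. f (x + \<zeta> *\<^sub>C v)) has_derivative (\<lambda>h. h *\<^sub>C D v)) (at \<zeta>)"
    using assms(2) by simp
  show "((\<lambda>\<zeta>. fst (f (x + \<zeta> *\<^sub>C v))) has_field_derivative fst (D v)) (at \<zeta>)"
    using has_derivative_fst[OF *] by (simp add: has_field_derivative_def mult_commute_abs)
  show "((\<lambda>\<zeta>. snd (f (x + \<zeta> *\<^sub>C v))) has_field_derivative snd (D v)) (at \<zeta>)"
    using has_derivative_snd[OF *] by (simp add: has_field_derivative_def mult_commute_abs)
qed

lemma holomorphic_on_line: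
  assumes "c2_holomorphic_on f UNIV"
  shows "(\<lambda>\<zeta>. fst (f (x + \<zeta> *\<^sub>C v))) holomorphic_on S"
    and "(\<lambda>\<zeta>. snd (f (x + \<zeta> *\<^sub>C v))) holomorphic_on S"
proof -
  have "\<exists>a. ((\<lambda>\<zeta>. fst (f (x + \<zeta> *\<^sub>C v))) has_field_derivative a) (at \<zeta>)"
    "\<exists>a. ((\<lambda>\<zeta>. snd (f (x + \<zeta> *\<^sub>C v))) has_field_derivative a) (at \<zeta>)" for \<zeta>
  proof -
    obtain D where D: "(f has_derivative D) (at (x + \<zeta> *\<^sub>C v))" "\<forall>c v. D (c *\<^sub>C v) = c *\<^sub>C D v"
      using assms unfolding c2_holomorphic_on_def by blast
    show "\<exists>a. ((\<lambda>\<zeta>. fst (f (x + \<zeta> *\<^sub>C v))) has_field_derivative a) (at \<zeta>)"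
      "\<exists>a. ((\<lambda>\<zeta>. snd (f (x + \<zeta> *\<^sub>C v))) has_field_derivative a) (at \<zeta>)"
      by (rule exI, rule c2_holomorphic_on_line[OF D])+
  qed
  then show "(\<lambda>\<zeta>. fst (f (x + \<zeta> *\<^sub>C v))) holomorphic_on S" "(\<lambda>\<zeta>. snd (f (x + \<zeta> *\<^sub>C v))) holomorphic_on S"
    by (auto simp: holomorphic_on_def field_differentiable_def intro: field_differentiable_at_within[unfolded field_differentiable_def])
qed

section \<open>Automorphisms of the plane and preimages under them\<close>

definition c2_automorphism :: "(c2 \<Rightarrow> c2) \<Rightarrow> bool" where
  "c2_automorphism f \<longleftrightarrow> c2_holomorphic_on f UNIV \<and>
     (\<exists>g. c2_holomorphic_on g UNIV \<and> (\<forall>x. g (f x) = x) \<and> (\<forall>x. f (g x) = x))"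

lemma c2_automorphismE:
  assumes "c2_automorphism f"
  obtains g where "c2_holomorphic_on f UNIV" "c2_holomorphic_on g UNIV"
    "\<And>x. g (f x) = x" "\<And>x. f (g x) = x"
  using assms unfolding c2_automorphism_def by blast

lemma c2_automorphism_comp:
  assumes "c2_automorphism f" "c2_automorphism g"
  shows "c2_automorphism (\<lambda>x. g (f x))"
proof -
  obtain f' where f: "c2_holomorphic_on f UNIV" "c2_holomorphic_on f' UNIV"
    "\<And>x. f' (f x) = x" "\<And>x. f (f' x) = x" using c2_automorphismE[OF assms(1)] by blast
  obtain g' where g: "c2_holomorphic_on g UNIV" "c2_holomorphic_on g' UNIV"
    "\<And>x. g' (g x) = x" "\<And>x. g (g' x) = x" using c2_automorphismE[OF assms(2)] by blast
  show ?thesis unfolding c2_automorphism_def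
    using c2_holomorphic_on_comp[OF f(1) g(1)] c2_holomorphic_on_comp[OF g(2) f(2)] f(3,4) g(3,4)
    by (intro conjI exI[of _ "\<lambda>x. f' (g' x)"]) auto
qed

lemma c2_automorphism_id: "c2_automorphism (\<lambda>x. x)"
  using c2_holomorphic_on_poly_sums[of "[:0,1:]" 0 0 "[:0,1:]"]
  unfolding c2_automorphism_def by (intro conjI exI[of _ "\<lambda>x. x"]) auto

lemma c2_automorphism_funpow:
  assumes "c2_automorphism f"
  shows "c2_automorphism (f ^^ n)"
proof (induction n)
  case 0
  then show ?case using c2_automorphism_id by (simp add: id_def)
next
  case (Suc n)
  then show ?case using c2_automorphism_comp[OF Suc assms] by (simp add: comp_def)
qed

lemma c2_automorphism_homeomorphism:
  assumes "c2_automorphism f"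
  obtains g where "homeomorphism UNIV UNIV f g"
proof -
  obtain g where g: "c2_holomorphic_on f UNIV" "c2_holomorphic_on g UNIV"
    "\<And>x. g (f x) = x" "\<And>x. f (g x) = x" using c2_automorphismE[OF assms] by blast
  then have "surj f" "surj g" using surjI[of f g] surjI[of g f] by blast+
  then have "homeomorphism UNIV UNIV f g"
    unfolding homeomorphism_def using g c2_holomorphic_imp_continuous by blast
  then show thesis using that by blast
qed

lemma c2_automorphism_vimage_eq_image:
  assumes "homeomorphism UNIV UNIV f g"
  shows "f -` U = g ` U"
proof
  show "f -` U \<subseteq> g ` U" using assms unfolding homeomorphism_def by (force simp: image_iff)
  show "g ` U \<subseteq> f -` U" using assms unfolding homeomorphism_def by auto
qed

lemma open_c2_automorphism_vimage:
  assumes "c2_automorphism f" "open U"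
  shows "open (f -` U)"
  using assms unfolding c2_automorphism_def by (blast intro: c2_holomorphic_imp_continuous open_vimage)

lemma connected_c2_automorphism_vimage:
  assumes "c2_automorphism f" "connected U"
  shows "connected (f -` U)"
proof -
  obtain g where g: "homeomorphism UNIV UNIV f g" using assms c2_automorphism_homeomorphism by blast
  then have "continuous_on U g" using continuous_on_subset unfolding homeomorphism_def by blast
  then show ?thesis using c2_automorphism_vimage_eq_image[OF g] assms(2) connected_continuous_image by metis
qed

lemma compact_c2_automorphism_vimage:
  assumes "c2_automorphism f" "compact U"
  shows "compact (f -` U)"
proof -
  obtain g where g: "homeomorphism UNIV UNIV f g" using assms c2_automorphism_homeomorphism by blast
  then have "continuous_on U g" using continuous_on_subset unfolding homeomorphism_def by blast
  then show ?thesis using c2_automorphism_vimage_eq_image[OF g] assms(2) compact_continuous_image by metis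
qed

text \<open>A global homeomorphism commutes with closure; this reduces closures of the Loewner
  domains to the closed polydisc.\<close>

lemma closure_c2_automorphism_vimage:
  assumes "c2_automorphism f"
  shows "closure (f -` U) = f -` closure U"
proof -
  obtain g where g: "homeomorphism UNIV UNIV f g" using assms c2_automorphism_homeomorphism by blast
  then have h: "homeomorphism UNIV UNIV g f" by (rule homeomorphism_symD)
  then have "bij g" unfolding homeomorphism_def bij_def inj_def by (metis UNIV_I)
  then show ?thesis
    unfolding c2_automorphism_vimage_eq_image[OF g]
    using closure_bij_homeomorphic_image_eq[OF _ h, of UNIV UNIV U] h
    by (auto simp: homeomorphism_def)
qed

lemma biholomorphic_c2_automorphism_vimage:
  assumes "c2_automorphism f" "open U"
  shows "biholomorphic (f -` U) U"
proof -
  obtain g where g: "c2_holomorphic_on f UNIV" "c2_holomorphic_on g UNIV"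
    "\<And>x. g (f x) = x" "\<And>x. f (g x) = x" using c2_automorphismE[OF assms(1)] by blast
  show ?thesis unfolding biholomorphic_def
    using open_c2_automorphism_vimage[OF assms] assms(2) g
      c2_holomorphic_on_subset[OF g(1)] c2_holomorphic_on_subset[OF g(2)]
    by (intro conjI exI[of _ f] exI[of _ g]) auto
qed

lemma c2_domain_c2_automorphism_vimage:
  assumes "c2_automorphism f" "c2_domain U"
  shows "c2_domain (f -` U)"
proof -
  obtain u where "u \<in> U" using assms(2) unfolding c2_domain_def by blast
  moreover obtain x where "f x = u" using assms(1) unfolding c2_automorphism_def by blast
  ultimately have "f -` U \<noteq> {}" by auto
  then show ?thesis
    using assms open_c2_automorphism_vimage connected_c2_automorphism_vimage unfolding c2_domain_def by blast
qed

lemma c2_automorphism_scale: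
  assumes "R \<noteq> 0"
  shows "c2_automorphism (\<lambda>x. R *\<^sub>R x)"
proof -
  have "c2_holomorphic_on (\<lambda>x. c *\<^sub>R x) UNIV" for c :: real
    using c2_holomorphic_on_poly_sums[of "[:0,complex_of_real c:]" 0 0 "[:0,complex_of_real c:]"]
    by (simp add: scaleR_eq_cscale cscale_def mult.commute)
  from this[of R] this[of "1/R"] show ?thesis
    unfolding c2_automorphism_def using assms by (intro conjI exI[of _ "\<lambda>x. (1/R) *\<^sub>R x"]) auto
qed

lemma unit_polydisc2_eq: "unit_polydisc2 = ball 0 1 \<times> ball 0 1"
  by (auto simp: unit_polydisc2_def)

lemma c2_domain_unit_polydisc2: "c2_domain unit_polydisc2"
  unfolding c2_domain_def unit_polydisc2_eq
  by (auto intro!: open_Times connected_Times)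

lemma closure_unit_polydisc2: "closure unit_polydisc2 = cball 0 1 \<times> cball 0 1"
  unfolding unit_polydisc2_eq closure_Times by simp

section \<open>Circle means\<close>

text \<open>The interval \<open>{0..a + T}\<close> can be cut at \<open>a\<close> or at
  \<open>T\<close>, and periodicity identifies the integral over \<open>{T..a + T}\<close> with that
  over \<open>{0..a}\<close>.\<close>

lemma integral_periodic_shift:
  fixes g :: "real \<Rightarrow> real"
  assumes cont: "continuous_on UNIV g" and per: "\<And>x. g (x + T) = g x" and "0 \<le> a" "0 \<le> T"
  shows "integral {a..a + T} g = integral {0..T} g"
proof -
  have int: "g integrable_on {x..y}" for x y
    using integrable_continuous_real continuous_on_subset[OF cont] by blast
  have "integral {0..T} g + integral {T..a + T} g = integral {0..a + T} g"
    using Henstock_Kurzweil_Integration.integral_combine[OF _ _ int] assms by simp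
  moreover have "integral {0..a} g + integral {a..a + T} g = integral {0..a + T} g"
    using Henstock_Kurzweil_Integration.integral_combine[OF _ _ int] assms by simp
  moreover have "integral {T..a + T} g = integral {0..a} g"
    using integral_shift_Icc_real[of 0 a g T] per by (simp add: comp_def add.commute)
  ultimately show ?thesis by simp
qed

text \<open>By uniform continuity each sampled value is at most \<open>g + e\<close> on its whole
  mesh interval once the mesh is fine. One \<open>N\<close> must serve every starting angle, because
  the maximum principle below needs a bound on the entire circle.\<close>

lemma riemann_sum_le_circle_mean:
  fixes g :: "real \<Rightarrow> real"
  assumes cont: "continuous_on UNIV g" and per: "\<And>x. g (x + 2 * pi) = g x" and e: "e > 0"
  obtains N :: nat where "N > 0"
    "\<And>\<theta>. 0 \<le> \<theta> \<Longrightarrow> \<theta> \<le> 2 * pi \<Longrightarrow>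
      (\<Sum>k<N. g (\<theta> + 2 * pi * real k / N)) \<le> N * (1 / (2 * pi) * integral {0..2 * pi} g + e)"
proof -
  \<comment> \<open>The starting angle and the range sampled from it each contribute up to
    \<open>2 * pi\<close>.\<close>
  have "uniformly_continuous_on {0..4 * pi} g"
    using continuous_on_subset[OF cont] by (intro compact_uniformly_continuous) auto
  then obtain d where d: "d > 0"
    "\<And>x y. x \<in> {0..4 * pi} \<Longrightarrow> y \<in> {0..4 * pi} \<Longrightarrow> dist y x < d \<Longrightarrow> dist (g y) (g x) < e"
    using e unfolding uniformly_continuous_on_def by metis
  obtain N :: nat where N: "2 * pi / d < N" using reals_Archimedean2 by blast
  moreover have "0 < 2 * pi / d" using d by simp
  ultimately have N0: "N > 0" by (metis gr0I less_asym of_nat_0)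
  define h where "h = 2 * pi / N"
  have h: "h > 0" "h < d" "N * h = 2 * pi"
  proof -
    show "h > 0" "N * h = 2 * pi" using N0 by (auto simp: h_def)
    have "2 * pi < N * d" using N d(1) by (simp add: pos_divide_less_eq)
    then show "h < d" using N0 by (simp add: h_def pos_divide_less_eq mult.commute)
  qed
  have int: "(\<lambda>x. g x + e) integrable_on {x..y}" for x y
    by (intro integrable_continuous_real continuous_intros continuous_on_subset[OF cont]) auto
  have "(\<Sum>k<N. g (\<theta> + 2 * pi * real k / N)) \<le> N * (1 / (2 * pi) * integral {0..2 * pi} g + e)"
    if \<theta>: "0 \<le> \<theta>" "\<theta> \<le> 2 * pi" for \<theta>
  proof -
    have "h * (\<Sum>k<j. g (\<theta> + real k * h)) \<le> integral {\<theta>..\<theta> + j * h} (\<lambda>x. g x + e)" if "j \<le> N" for j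
      using that
    proof (induction j)
      case 0
      then show ?case by simp
    next
      case (Suc j)
      let ?a = "\<theta> + j * h" and ?b = "\<theta> + Suc j * h"
      have "real (Suc j) * h \<le> N * h" using Suc.prems h by (intro mult_right_mono) auto
      then have b: "?b \<le> 4 * pi" using h \<theta> by simp
      have ab: "?b = ?a + h" by (simp add: algebra_simps)
      have a: "0 \<le> ?a" using \<theta> h by simp
      have "g ?a \<le> g x + e" if "x \<in> {?a..?b}" for x
      proof -
        have "dist x ?a < d" using that ab h by (simp add: dist_real_def)
        then have "dist (g x) (g ?a) < e" using d(2)[of ?a x] that a b ab h by simp
        then show ?thesis by (simp add: dist_real_def)
      qed
      then have "integral {?a..?b} (\<lambda>x. g ?a) \<le> integral {?a..?b} (\<lambda>x. g x + e)"
        using int by (intro integral_le) auto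
      then have "h * g ?a \<le> integral {?a..?b} (\<lambda>x. g x + e)"
        using h ab by simp
      moreover have "integral {\<theta>..?a} (\<lambda>x. g x + e) + integral {?a..?b} (\<lambda>x. g x + e)
          = integral {\<theta>..?b} (\<lambda>x. g x + e)"
        using h ab by (intro Henstock_Kurzweil_Integration.integral_combine int) auto
      ultimately show ?case using Suc by (simp add: distrib_left)
    qed
    from this[of N] have "h * (\<Sum>k<N. g (\<theta> + real k * h)) \<le> integral {\<theta>..\<theta> + 2 * pi} (\<lambda>x. g x + e)"
      using h by simp
    also have "\<dots> = integral {0..2 * pi} (\<lambda>x. g x + e)"
      using \<theta> by (intro integral_periodic_shift continuous_intros cont) (auto simp: per)
    also have "\<dots> = integral {0..2 * pi} g + 2 * pi * e"
      using integrable_continuous_real[OF continuous_on_subset[OF cont]]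
      by (subst Henstock_Kurzweil_Integration.integral_add) auto
    finally have "2 * pi / N * (\<Sum>k<N. g (\<theta> + real k * h)) \<le> integral {0..2 * pi} g + 2 * pi * e"
      unfolding h_def .
    moreover have "(\<Sum>k<N. g (\<theta> + 2 * pi * real k / N)) = (\<Sum>k<N. g (\<theta> + real k * h))"
      by (simp add: h_def mult.commute)
    ultimately show ?thesis using N0 by (simp add: field_simps)
  qed
  then show thesis using that N0 by blast
qed

text \<open>Applying the maximum principle to the product of the rotates of \<open>f\<close> by all \<open>N\<close>-th roots of
  unity bounds \<open>N * ln (cmod (f 0))\<close> by a Riemann sum of \<open>g\<close>.\<close>

lemma cmod_le_exp_circle_mean:
  fixes g :: "real \<Rightarrow> real"
  assumes f: "f holomorphic_on UNIV" and r: "r > 0"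
    and cont: "continuous_on UNIV g" and per: "\<And>x. g (x + 2 * pi) = g x"
    and le: "\<And>\<theta>. cmod (f (complex_of_real r * exp (\<i> * complex_of_real \<theta>))) \<le> exp (g \<theta>)"
  shows "cmod (f 0) \<le> exp (1 / (2 * pi) * integral {0..2 * pi} g)"
proof -
  let ?m = "1 / (2 * pi) * integral {0..2 * pi} g"
  have "cmod (f 0) \<le> exp (?m + e)" if e: "e > 0" for e
  proof -
    obtain N :: nat where N: "N > 0"
      "\<And>\<theta>. 0 \<le> \<theta> \<Longrightarrow> \<theta> \<le> 2 * pi \<Longrightarrow> (\<Sum>k<N. g (\<theta> + 2 * pi * real k / N)) \<le> N * (?m + e)"
      using riemann_sum_le_circle_mean[OF cont per e] by metis
    define P where "P = (\<lambda>z. \<Prod>k<N. f (exp (\<i> * complex_of_real (2 * pi * real k / N)) * z))"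
    have hol: "P holomorphic_on S" for S
      unfolding P_def
      by (intro holomorphic_intros holomorphic_on_compose_gen[OF _ f, unfolded comp_def]) auto
    have "cmod (P 0) \<le> exp (N * (?m + e))"
    proof (rule maximum_modulus_frontier[where S = "cball 0 r" and f = P])
      fix z :: complex assume "z \<in> frontier (cball 0 r)"
      then have z: "cmod z = r" using r by (simp add: frontier_cball)
      define \<theta> where "\<theta> = Arg2pi z"
      have zeq: "z = complex_of_real r * exp (\<i> * complex_of_real \<theta>)"
        using Arg2pi[of z] z unfolding \<theta>_def by (simp add: is_Arg_def)
      have \<theta>: "0 \<le> \<theta>" "\<theta> \<le> 2 * pi" using Arg2pi[of z] unfolding \<theta>_def by auto
      have "cmod (P z) = (\<Prod>k<N. cmod (f (exp (\<i> * complex_of_real (2 * pi * real k / N)) * z)))"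
        unfolding P_def by (simp add: prod_norm)
      also have "\<dots> \<le> (\<Prod>k<N. exp (g (\<theta> + 2 * pi * real k / N)))"
      proof (intro prod_mono conjI)
        fix k
        have "exp (\<i> * complex_of_real (2 * pi * real k / N)) * z
            = complex_of_real r * exp (\<i> * complex_of_real (\<theta> + 2 * pi * real k / N))"
          unfolding zeq of_real_add distrib_left exp_add by simp
        then show "cmod (f (exp (\<i> * complex_of_real (2 * pi * real k / N)) * z)) \<le> exp (g (\<theta> + 2 * pi * real k / N))"
          using le by metis
      qed auto
      also have "\<dots> = exp (\<Sum>k<N. g (\<theta> + 2 * pi * real k / N))" by (simp add: exp_sum)
      also have "\<dots> \<le> exp (N * (?m + e))" using N(2)[OF \<theta>] by (subst exp_le_cancel_iff)
      finally show "cmod (P z) \<le> exp (N * (?m + e))" .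
    qed (use r hol holomorphic_on_imp_continuous_on in auto)
    \<comment> \<open>All rotates agree at the origin, so \<open>P 0\<close> is
      \<open>f 0 ^ N\<close>. Taking roots instead of logarithms also covers
      \<open>f 0 = 0\<close>.\<close>
    then have "cmod (f 0) ^ N \<le> exp (?m + e) ^ N"
      by (simp add: P_def norm_power exp_of_nat_mult)
    then show ?thesis using N by (simp add: power_mono_iff)
  qed
  then have "cmod (f 0) \<le> exp ?m * exp e" if "e > 0" for e
    using that by (simp add: exp_add)
  then have *: "\<forall>\<^sub>F e in at_right 0. cmod (f 0) \<le> exp ?m * exp e"
    by (auto simp: eventually_at_right_field intro: exI[of _ 1])
  have "((\<lambda>e. exp ?m * exp e) \<longlongrightarrow> exp ?m * exp 0) (at_right 0)"
    by (intro tendsto_intros)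
  from tendsto_lowerbound[OF this *] show ?thesis by simp
qed

text \<open>For a nonnegative function the negative part in \<open>circle_mean\<close> integrates to
  \<open>0\<close>, so the extended real difference is an ordinary Lebesgue integral.\<close>

lemma circle_mean_nonneg_eq:
  assumes nn: "\<And>x. \<phi> x \<ge> 0"
    and int: "set_integrable lborel {0..2*pi} (\<lambda>\<theta>. \<phi> (a + (complex_of_real r * exp (\<i> * complex_of_real \<theta>)) *\<^sub>C b))"
  shows "circle_mean (\<lambda>x. ereal (\<phi> x)) a b r = ereal (1 / (2 * pi) *
    (LINT \<theta>:{0..2*pi}|lborel. \<phi> (a + (complex_of_real r * exp (\<i> * complex_of_real \<theta>)) *\<^sub>C b)))"
proof -
  let ?g = "\<lambda>\<theta>. \<phi> (a + (complex_of_real r * exp (\<i> * complex_of_real \<theta>)) *\<^sub>C b)"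
  have "(\<integral>\<^sup>+ \<theta>. e2ennreal (ereal (?g \<theta>)) * indicator {0..2*pi} \<theta> \<partial>lborel)
      = (\<integral>\<^sup>+ \<theta>. ennreal (indicator {0..2*pi} \<theta> *\<^sub>R ?g \<theta>) \<partial>lborel)"
    by (intro nn_integral_cong) (auto simp: indicator_def)
  also have "\<dots> = ennreal (LINT \<theta>:{0..2*pi}|lborel. ?g \<theta>)"
    unfolding set_lebesgue_integral_def
    using int nn by (intro nn_integral_eq_integral) (auto simp: set_integrable_def indicator_def)
  finally have "enn2ereal (\<integral>\<^sup>+ \<theta>. e2ennreal (ereal (?g \<theta>)) * indicator {0..2*pi} \<theta> \<partial>lborel)
      = ereal (LINT \<theta>:{0..2*pi}|lborel. ?g \<theta>)"
    using nn by (simp add: set_lebesgue_integral_def)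
  moreover have "e2ennreal (- ereal (?g \<theta>)) = 0" for \<theta>
    using nn by (intro e2ennreal_neg) simp
  ultimately show ?thesis
    unfolding circle_mean_def by (simp only: mult_zero_left nn_integral_const) (simp add: zero_ennreal.rep_eq)
qed

section \<open>Discs, gauges and Loewner families\<close>

text \<open>A disc with derivative \<open>\<mu> *\<^sub>R v\<close> makes \<open>1 / \<mu>\<close>
  admissible, so every positive number belongs to the set whose infimum is taken.\<close>

lemma kobayashi_royden_eq_0:
  assumes "\<And>\<mu>. \<mu> > 0 \<Longrightarrow> \<exists>f. disc_holomorphic f \<and> f ` ball 0 1 \<subseteq> \<Omega> \<and> f 0 = x \<and> disc_deriv0 f = \<mu> *\<^sub>R v"
  shows "kobayashi_royden \<Omega> x v = 0"
proof -
  let ?A = "{\<alpha>::real. \<alpha> > 0 \<and>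
      (\<exists>f. disc_holomorphic f \<and> f ` ball 0 1 \<subseteq> \<Omega> \<and> f 0 = x \<and> \<alpha> *\<^sub>R disc_deriv0 f = v)}"
  have mem: "\<epsilon> \<in> ?A" if "\<epsilon> > 0" for \<epsilon> :: real
  proof -
    have "1 / \<epsilon> > 0" using that by simp
    from assms[OF this] obtain f where
      "disc_holomorphic f" "f ` ball 0 1 \<subseteq> \<Omega>" "f 0 = x" "disc_deriv0 f = (1 / \<epsilon>) *\<^sub>R v" by blast
    then show ?thesis using that by auto
  qed
  have "?A \<noteq> {}" using mem[OF zero_less_one] by blast
  then have "Inf ?A \<ge> 0" by (rule cInf_greatest) auto
  moreover have "bdd_below ?A"
    by (rule bdd_belowI[of _ 0]) simp
  then have "Inf ?A \<le> 0 + \<epsilon>" if "\<epsilon> > 0" for \<epsilon> :: real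
    using cInf_lower[OF mem[OF that]] by simp
  then have "Inf ?A \<le> 0" by (rule field_le_epsilon)
  ultimately show ?thesis
    unfolding kobayashi_royden_def by (intro antisym)
qed

lemma exp_power_unbounded:
  fixes d :: nat and C r :: real
  assumes "d \<ge> 2" "r > 0"
  obtains N :: nat where "\<And>n. n \<ge> N \<Longrightarrow> C < exp (real d ^ n * r)"
proof -
  obtain N :: nat where N: "C / r < N" using reals_Archimedean2 by blast
  have "C < exp (real d ^ n * r)" if "n \<ge> N" for n
  proof -
    have "C / r < real n" using N that by linarith
    also have "real n < 2 ^ n" by (rule of_nat_less_two_power)
    also have "\<dots> \<le> real d ^ n" using assms by (intro power_mono) auto
    finally have "C < real d ^ n * r" using assms by (simp add: pos_divide_less_eq)
    also have "\<dots> < exp (real d ^ n * r)" using exp_ge_add_one_self[of "real d ^ n * r"] by linarith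
    finally show ?thesis .
  qed
  then show thesis using that by blast
qed

text \<open>Cauchy-Schwarz for the Hermitian product, reduced to the real inner product of the
  vectors of moduli. It later allows a vector norm to be replaced by the modulus of one holomorphic
  function.\<close>

lemma cmod_cnj_pairing_le:
  fixes u v :: c2
  shows "cmod (cnj (fst u) * fst v + cnj (snd u) * snd v) \<le> norm u * norm v"
proof -
  have "cmod (cnj (fst u) * fst v + cnj (snd u) * snd v)
      \<le> cmod (fst u) * cmod (fst v) + cmod (snd u) * cmod (snd v)"
    by (rule norm_triangle_le) (simp add: norm_mult)
  also have "\<dots> = inner (cmod (fst u), cmod (snd u)) (cmod (fst v), cmod (snd v))" by simp
  also have "\<dots> \<le> norm (cmod (fst u), cmod (snd u)) * norm (cmod (fst v), cmod (snd v))"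
    by (rule norm_cauchy_schwarz)
  also have "\<dots> = norm u * norm v" by (simp add: norm_prod_def)
  finally show ?thesis .
qed

lemma cmod_fst_le: "cmod (fst x) \<le> norm (x :: c2)"
  and cmod_snd_le: "cmod (snd x) \<le> norm (x :: c2)"
  using norm_fst_le[of "fst x" "snd x"] norm_snd_le[of "snd x" "fst x"] by simp_all

text \<open>Serves Loewner condition (3): if \<open>\<phi>\<close> is the gauge of a fixed point as
  a function of time, membership in the open domain already holds slightly earlier.\<close>

lemma continuous_on_step_left:
  fixes \<phi> :: "real \<Rightarrow> real"
  assumes cont: "continuous_on {0..u} \<phi>" and t: "0 < t" "t \<le> u" and less: "\<phi> t < 1"
  shows "\<exists>t'\<in>{0..<t}. \<phi> t' < 1"
proof -
  obtain \<epsilon> where \<epsilon>: "\<epsilon> > 0" "\<And>t'. t' \<in> {0..u} \<Longrightarrow> dist t' t < \<epsilon> \<Longrightarrow> dist (\<phi> t') (\<phi> t) < 1 - \<phi> t"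
    using cont t less unfolding continuous_on_iff
    by (metis atLeastAtMost_iff diff_gt_0_iff_gt less_imp_le)
  let ?t = "max 0 (t - \<epsilon> / 2)"
  have "dist (\<phi> ?t) (\<phi> t) < 1 - \<phi> t"
    using \<epsilon>(1) t by (intro \<epsilon>(2)) (auto simp: dist_real_def)
  then show ?thesis
    using \<epsilon>(1) t by (intro bexI[of _ ?t]) (auto simp: dist_real_def)
qed

text \<open>Serves Loewner condition (4): a point of all later open domains has gauge at most 1 in
  the limit, so it lies in the closure.\<close>

lemma continuous_on_step_right:
  fixes \<phi> :: "real \<Rightarrow> real"
  assumes cont: "continuous_on {0..u} \<phi>" and t: "0 \<le> t" "t < u"
    and less: "\<And>t'. t < t' \<Longrightarrow> \<phi> t' < 1"
  shows "\<phi> t \<le> 1"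
proof (rule ccontr)
  assume "\<not> \<phi> t \<le> 1"
  then obtain \<epsilon> where \<epsilon>: "\<epsilon> > 0" "\<And>t'. t' \<in> {0..u} \<Longrightarrow> dist t' t < \<epsilon> \<Longrightarrow> dist (\<phi> t') (\<phi> t) < \<phi> t - 1"
    using cont t unfolding continuous_on_iff
    by (metis atLeastAtMost_iff diff_gt_0_iff_gt less_imp_le not_le)
  let ?t = "min u (t + \<epsilon> / 2)"
  have "dist (\<phi> ?t) (\<phi> t) < \<phi> t - 1"
    using \<epsilon>(1) t by (intro \<epsilon>(2)) (auto simp: dist_real_def)
  moreover have "\<phi> ?t < 1" using \<epsilon>(1) t by (intro less) auto
  ultimately show False by (simp add: dist_real_def)
qed

text \<open>The maximum norm, whose open and closed unit balls are the polydisc and its closure. It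
  turns the Loewner conditions into real inequalities.\<close>

definition gauge2 :: "c2 \<Rightarrow> real" where
  "gauge2 x = max (cmod (fst x)) (cmod (snd x))"

lemma unit_polydisc2_gauge2: "x \<in> unit_polydisc2 \<longleftrightarrow> gauge2 x < 1"
  by (cases x) (auto simp: unit_polydisc2_def gauge2_def)

lemma closure_unit_polydisc2_gauge2: "x \<in> closure unit_polydisc2 \<longleftrightarrow> gauge2 x \<le> 1"
  unfolding closure_unit_polydisc2 by (cases x) (auto simp: gauge2_def)

text \<open>The domains are the preimages of the polydisc under \<open>T t\<close>. Assumption
  \<open>mono\<close> gives (2) and the easy inclusions of (3) and (4); \<open>cont\<close> gives
  the reverse inclusions.\<close>

lemma loewner_short_C2I:
  fixes T :: "real \<Rightarrow> c2 \<Rightarrow> c2"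
  assumes short: "short_C2 \<Omega>"
    and union: "(\<Union>t\<in>{0..}. {x. gauge2 (T t x) < 1}) = \<Omega>"
    and aut: "\<And>t. t \<ge> 0 \<Longrightarrow> c2_automorphism (T t)"
    and mono: "\<And>t s x. 0 \<le> t \<Longrightarrow> t < s \<Longrightarrow> gauge2 (T t x) \<le> 1 \<Longrightarrow> gauge2 (T s x) < 1"
    and cont: "\<And>n x. continuous_on {0..real n} (\<lambda>t. gauge2 (T t x))"
  shows "loewner_short_C2 \<Omega>"
proof -
  define F where "F = (\<lambda>t. {x. gauge2 (T t x) < 1})"
  have F_vimage: "F t = T t -` unit_polydisc2" for t
    by (auto simp: F_def unit_polydisc2_gauge2)
  have clF: "closure (F t) = {x. gauge2 (T t x) \<le> 1}" if "t \<ge> 0" for t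
    unfolding F_vimage closure_c2_automorphism_vimage[OF aut[OF that]]
    by (auto simp: closure_unit_polydisc2_gauge2)
  have cptF: "compact (closure (F t))" if "t \<ge> 0" for t
    unfolding F_vimage closure_c2_automorphism_vimage[OF aut[OF that]]
    by (intro compact_c2_automorphism_vimage[OF aut[OF that]])
       (auto simp: closure_unit_polydisc2 intro: compact_Times)
  have less: "F t \<subseteq> F s" "closure (F t) \<subseteq> F s" if "0 \<le> t" "t < s" for t s
    using mono[OF that] that unfolding clF[OF that(1)] by (auto simp: F_def)
  have "(\<Union>t\<in>{0..}. F t) = \<Omega>" using union by (simp add: F_def)
  moreover have "\<forall>t\<ge>0. c2_domain (F t)"
    unfolding F_vimage using c2_domain_c2_automorphism_vimage[OF aut c2_domain_unit_polydisc2] by blast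
  moreover have "\<forall>t\<ge>0. biholomorphic (F t) unit_polydisc2"
    unfolding F_vimage using biholomorphic_c2_automorphism_vimage[OF aut] c2_domain_unit_polydisc2
    unfolding c2_domain_def by blast
  moreover have "\<forall>t s. 0 \<le> t \<and> t < s \<longrightarrow> rel_compact_in (F t) (F s)"
    unfolding rel_compact_in_def using cptF less by blast
  moreover have "F t = (\<Union>t'\<in>{0..<t}. F t')" if "t > 0" for t
  proof
    show "(\<Union>t'\<in>{0..<t}. F t') \<subseteq> F t" by (rule UN_least) (use less(1) in simp)
    obtain n :: nat where "t \<le> n" using real_arch_simple by blast
    then show "F t \<subseteq> (\<Union>t'\<in>{0..<t}. F t')"
      using continuous_on_step_left[OF cont \<open>t > 0\<close>] unfolding F_def by blast
  qed
  moreover have "closure (F t') = (\<Inter>t\<in>{t'<..}. F t)" if "t' \<ge> 0" for t'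
  proof
    show "closure (F t') \<subseteq> (\<Inter>t\<in>{t'<..}. F t)" by (rule INT_greatest) (use less(2) that in simp)
    obtain n :: nat where "t' < n" using reals_Archimedean2 by blast
    then show "(\<Inter>t\<in>{t'<..}. F t) \<subseteq> closure (F t')"
      unfolding clF[OF that] using continuous_on_step_right[OF cont that] unfolding F_def by blast
  qed
  ultimately show ?thesis
    unfolding loewner_short_C2_def using short by blast
qed

text \<open>The shear \<open>(z, w) \<mapsto> (z, \<delta> w + s p(z))\<close> interpolates between a diagonal map (\<open>s = 0\<close>)
  and the map \<open>henon p \<delta>\<close> with swapped coordinates (\<open>s = 1\<close>).\<close>

lemma c2_automorphism_shear:
  assumes "b \<noteq> 0" "c \<noteq> 0" "\<delta> \<noteq> 0"
  shows "c2_automorphism (\<lambda>x. (fst x / b, (\<delta> * snd x + s * poly p (fst x)) / c))"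
proof -
  define f :: "c2 \<Rightarrow> c2" where "f = (\<lambda>x. (fst x / b, (\<delta> * snd x + s * poly p (fst x)) / c))"
  define g :: "c2 \<Rightarrow> c2" where "g = (\<lambda>x. (b * fst x, (c * snd x - s * poly p (b * fst x)) / \<delta>))"
  have f: "f = (\<lambda>x. (poly [:0, 1 / b:] (fst x) + poly 0 (snd x),
      poly (smult (s / c) p) (fst x) + poly [:0, \<delta> / c:] (snd x)))"
    by (auto simp: f_def fun_eq_iff add_divide_distrib)
  have g: "g = (\<lambda>x. (poly [:0, b:] (fst x) + poly 0 (snd x),
      poly (smult (- s / \<delta>) (pcompose p [:0, b:])) (fst x) + poly [:0, c / \<delta>:] (snd x)))"
    by (auto simp: g_def fun_eq_iff diff_divide_distrib poly_pcompose mult.commute)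
  have "c2_holomorphic_on f UNIV" unfolding f by (rule c2_holomorphic_on_poly_sums)
  moreover have "c2_holomorphic_on g UNIV" unfolding g by (rule c2_holomorphic_on_poly_sums)
  moreover have "g (f x) = x" "f (g x) = x" for x
    using assms by (auto simp: f_def g_def prod_eq_iff)
  ultimately have "c2_automorphism f" unfolding c2_automorphism_def by blast
  then show ?thesis unfolding f_def .
qed

section \<open>The Green's function of a Henon map\<close>

locale henon_map =
  fixes p :: "complex poly" and \<delta> :: complex
  assumes degree_ge_2: "degree p \<ge> 2" and delta_nonzero: "\<delta> \<noteq> 0"
begin

abbreviation d :: nat where "d \<equiv> degree p"
abbreviation H :: "c2 \<Rightarrow> c2" where "H \<equiv> henon p \<delta>"
abbreviation G :: "c2 \<Rightarrow> real" where "G \<equiv> green_plus H d"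

definition coeff_sum :: real where "coeff_sum = (\<Sum>i\<le>d. cmod (coeff p i))"

definition K :: real where "K = coeff_sum + cmod \<delta> + 1"

text \<open>The lower bound 1 turns \<open>log_plus\<close> into a plain \<open>ln\<close> and lets
  lower powers be absorbed into the \<open>d\<close>-th power.\<close>

definition orbit_norm :: "nat \<Rightarrow> c2 \<Rightarrow> real" where
  "orbit_norm n x = max 1 (norm ((H ^^ n) x))"

text \<open>The correction \<open>ln K\<close> makes these approximations of the Green's function decrease in \<open>n\<close>.\<close>

definition green_approx :: "nat \<Rightarrow> c2 \<Rightarrow> real" where
  "green_approx n x = (ln (orbit_norm n x) + ln K) / d ^ n"

lemma coeff_sum_nonneg: "coeff_sum \<ge> 0"
  by (simp add: coeff_sum_def sum_nonneg)

lemma K_ge_1: "K \<ge> 1"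
  using coeff_sum_nonneg by (simp add: K_def)

lemma H_simps [simp]: "fst (H x) = poly p (fst x) + \<delta> * snd x" "snd (H x) = fst x"
  by (simp_all add: henon_def case_prod_beta)

lemma cmod_poly_le:
  assumes "R \<ge> 1" "cmod z \<le> R"
  shows "cmod (poly p z) \<le> coeff_sum * R ^ d"
proof -
  have "cmod (poly p z) \<le> (\<Sum>i\<le>d. cmod (coeff p i) * cmod z ^ i)"
    unfolding poly_altdef by (rule order_trans[OF norm_sum]) (simp add: norm_mult norm_power)
  also have "\<dots> \<le> (\<Sum>i\<le>d. cmod (coeff p i) * R ^ d)"
  proof (intro sum_mono mult_left_mono)
    fix i assume "i \<in> {..d}"
    have "cmod z ^ i \<le> R ^ i" using assms by (intro power_mono) auto
    also have "\<dots> \<le> R ^ d" using assms \<open>i \<in> {..d}\<close> by (intro power_increasing) auto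
    finally show "cmod z ^ i \<le> R ^ d" .
  qed auto
  finally show ?thesis by (simp add: coeff_sum_def sum_distrib_right)
qed

lemma c2_automorphism_H: "c2_automorphism H"
proof -
  define H' :: "c2 \<Rightarrow> c2" where "H' = (\<lambda>x. (snd x, (fst x - poly p (snd x)) / \<delta>))"
  have 1: "H = (\<lambda>x. (poly p (fst x) + poly [:0, \<delta>:] (snd x), poly [:0, 1:] (fst x) + poly 0 (snd x)))"
    by (auto simp: henon_def fun_eq_iff mult.commute)
  have 2: "H' = (\<lambda>x. (poly 0 (fst x) + poly [:0, 1:] (snd x),
      poly [:0, 1 / \<delta>:] (fst x) + poly (smult (- 1 / \<delta>) p) (snd x)))"
    by (auto simp: H'_def fun_eq_iff diff_divide_distrib)
  have "c2_holomorphic_on H UNIV" "c2_holomorphic_on H' UNIV"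
    unfolding 1 2 by (rule c2_holomorphic_on_poly_sums)+
  then show ?thesis
    unfolding c2_automorphism_def
    using delta_nonzero by (intro conjI exI[of _ H']) (auto simp: H'_def prod_eq_iff)
qed

lemma c2_automorphism_iterate: "c2_automorphism (H ^^ n)"
  by (rule c2_automorphism_funpow[OF c2_automorphism_H])

lemma c2_holomorphic_iterate: "c2_holomorphic_on (H ^^ n) UNIV"
  using c2_automorphism_iterate unfolding c2_automorphism_def by blast

lemma continuous_iterate: "continuous_on UNIV (H ^^ n)"
  by (rule c2_holomorphic_imp_continuous[OF c2_holomorphic_iterate])

lemma orbit_norm_ge_1: "orbit_norm n x \<ge> 1"
  by (simp add: orbit_norm_def)

text \<open>The three summands of \<open>K\<close> pay for \<open>p(z)\<close>, for
  \<open>\<delta> w\<close> and for the second coordinate \<open>z\<close> of the image.\<close>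

lemma orbit_norm_Suc: "orbit_norm (Suc n) x \<le> K * orbit_norm n x ^ d"
proof -
  define y where "y = (H ^^ n) x"
  have m1: "orbit_norm n x \<ge> 1" by (rule orbit_norm_ge_1)
  have yn: "norm y \<le> orbit_norm n x" by (simp add: orbit_norm_def y_def)
  have y: "cmod (fst y) \<le> orbit_norm n x" "cmod (snd y) \<le> orbit_norm n x"
    using norm_fst_le[of "fst y" "snd y"] norm_snd_le[of "snd y" "fst y"] yn by auto
  have md: "orbit_norm n x \<le> orbit_norm n x ^ d"
    using m1 degree_ge_2 power_increasing[of 1 d "orbit_norm n x"] by simp
  have "norm (H y) \<le> cmod (poly p (fst y) + \<delta> * snd y) + cmod (fst y)"
    using norm_c2_le[of "H y"] by simp
  also have "cmod (poly p (fst y) + \<delta> * snd y) \<le> cmod (poly p (fst y)) + cmod \<delta> * cmod (snd y)"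
    by (metis norm_mult norm_triangle_ineq)
  also have "cmod (poly p (fst y)) \<le> coeff_sum * orbit_norm n x ^ d" by (rule cmod_poly_le[OF m1 y(1)])
  also have "cmod \<delta> * cmod (snd y) \<le> cmod \<delta> * orbit_norm n x ^ d"
    using y md by (intro mult_left_mono) auto
  also have "cmod (fst y) \<le> orbit_norm n x ^ d" using y md by simp
  finally have "norm (H y) \<le> K * orbit_norm n x ^ d" by (simp add: K_def algebra_simps)
  moreover have "1 * 1 \<le> K * orbit_norm n x ^ d"
    using K_ge_1 m1 by (intro mult_mono) auto
  ultimately show ?thesis by (simp add: orbit_norm_def y_def)
qed

lemma green_approx_nonneg: "green_approx n x \<ge> 0"
  using orbit_norm_ge_1[of n x] K_ge_1 by (simp add: green_approx_def)

text \<open>One application of \<open>H\<close> raises the constant to \<open>2 * ln K\<close>. This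
  is at most \<open>d * ln K\<close>, and division by \<open>d ^ Suc n\<close> then gives back the
  previous term.\<close>

lemma green_approx_Suc_le: "green_approx (Suc n) x \<le> green_approx n x"
proof -
  have d: "d > 0" using degree_ge_2 by simp
  have k: "K > 0" "orbit_norm n x > 0" "orbit_norm (Suc n) x > 0"
    using K_ge_1 orbit_norm_ge_1[of n x] orbit_norm_ge_1[of "Suc n" x] by auto
  have "ln (orbit_norm (Suc n) x) \<le> ln (K * orbit_norm n x ^ d)"
    using orbit_norm_Suc k by simp
  also have "\<dots> = ln K + d * ln (orbit_norm n x)"
    using k by (simp add: ln_mult ln_realpow)
  finally have "ln (orbit_norm (Suc n) x) + ln K \<le> 2 * ln K + d * ln (orbit_norm n x)" by simp
  also have "\<dots> \<le> d * ln K + d * ln (orbit_norm n x)"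
    using degree_ge_2 K_ge_1 by (intro add_right_mono mult_right_mono) auto
  finally have "green_approx (Suc n) x \<le> (d * ln K + d * ln (orbit_norm n x)) / d ^ Suc n"
    unfolding green_approx_def by (intro divide_right_mono) auto
  also have "\<dots> = green_approx n x"
    using d by (simp add: green_approx_def distrib_left[symmetric] add.commute)
  finally show ?thesis .
qed

lemma green_approx_decseq: "decseq (\<lambda>n. green_approx n x)"
  using green_approx_Suc_le by (intro decseq_SucI)

lemma log_plus_eq: "log_plus (norm ((H ^^ n) x)) = ln (orbit_norm n x)"
  \<comment> \<open>At norm zero \<open>ln 0\<close> is a default value, so this case is split off;
    both sides are then \<open>0\<close>.\<close>
  unfolding log_plus_def orbit_norm_def by (cases "norm ((H ^^ n) x) = 0") (auto simp: max_def)

lemma K_term_tendsto: "(\<lambda>n. ln K / real d ^ n) \<longlonglongrightarrow> 0"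
  using degree_ge_2 by (intro LIMSEQ_divide_realpow_zero) auto

lemma G_tendsto:
  shows "(\<lambda>n. ln (orbit_norm n x) / real d ^ n) \<longlonglongrightarrow> G x" and "(\<lambda>n. green_approx n x) \<longlonglongrightarrow> G x"
proof -
  obtain L where L: "(\<lambda>n. green_approx n x) \<longlonglongrightarrow> L"
    using decseq_convergent[OF green_approx_decseq, of 0 x] green_approx_nonneg by blast
  have "(\<lambda>n. green_approx n x - ln K / real d ^ n) \<longlonglongrightarrow> L - 0"
    by (intro tendsto_diff L K_term_tendsto)
  then have *: "(\<lambda>n. ln (orbit_norm n x) / real d ^ n) \<longlonglongrightarrow> L"
    by (simp add: green_approx_def add_divide_distrib)
  then have "G x = L"
    unfolding green_plus_def log_plus_eq by (rule limI)
  with * L show "(\<lambda>n. ln (orbit_norm n x) / real d ^ n) \<longlonglongrightarrow> G x" "(\<lambda>n. green_approx n x) \<longlonglongrightarrow> G x" by auto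
qed

section \<open>Sublevel sets of the Green's function and of its approximations\<close>

lemma G_le_green_approx: "G x \<le> green_approx n x"
  by (rule decseq_ge[OF green_approx_decseq G_tendsto(2)])

lemma G_nonneg: "G x \<ge> 0"
  by (rule LIMSEQ_le_const[OF G_tendsto(2)]) (use green_approx_nonneg in auto)

text \<open>Since the approximations decrease, a strict bound on the limit is reached at a finite
  stage. Openness and the exhaustion of sublevel sets follow from this.\<close>

lemma G_less_iff: "G x < c \<longleftrightarrow> (\<exists>n. green_approx n x < c)"
proof
  assume "G x < c"
  then have "\<forall>\<^sub>F n in sequentially. green_approx n x < c"
    by (rule order_tendstoD(2)[OF G_tendsto(2)])
  then show "\<exists>n. green_approx n x < c" by (auto simp: eventually_sequentially)
next
  assume "\<exists>n. green_approx n x < c"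
  then show "G x < c" by (auto intro: le_less_trans[OF G_le_green_approx])
qed

lemma green_approx_less_iff:
  fixes c :: real
  shows "green_approx n x < c \<longleftrightarrow> orbit_norm n x < exp (d ^ n * c) / K"
proof -
  have "green_approx n x < c \<longleftrightarrow> ln (orbit_norm n x) < d ^ n * c - ln K"
    using degree_ge_2 by (simp add: green_approx_def pos_divide_less_eq mult.commute less_diff_eq)
  also have "\<dots> \<longleftrightarrow> orbit_norm n x < exp (d ^ n * c - ln K)"
    using orbit_norm_ge_1[of n x] by (subst exp_less_cancel_iff[symmetric]) simp
  also have "exp (d ^ n * c - ln K) = exp (d ^ n * c) / K"
    using K_ge_1 by (simp add: exp_diff)
  finally show ?thesis .
qed

lemma continuous_green_approx: "continuous_on UNIV (green_approx n)"
proof -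
  have "continuous_on UNIV (orbit_norm n)"
    unfolding orbit_norm_def by (intro continuous_intros continuous_iterate)
  then show ?thesis
    unfolding green_approx_def
    by (intro continuous_intros) (use degree_ge_2 in \<open>auto simp: orbit_norm_def max_def\<close>)
qed

lemma open_green_approx_less: "open {x. green_approx n x < c}"
  using continuous_green_approx by (intro open_Collect_less) auto

lemma open_G_less: "open {x. G x < c}"
proof -
  have "{x. G x < c} = (\<Union>n. {x. green_approx n x < c})" by (auto simp: G_less_iff)
  then show ?thesis using open_green_approx_less by auto
qed

lemma G_H: "G (H x) = d * G x"
proof -
  have "ln (orbit_norm n (H x)) / real d ^ n = d * (ln (orbit_norm (Suc n) x) / real d ^ Suc n)" for n
    using degree_ge_2 by (simp add: orbit_norm_def funpow_swap1)
  moreover have "(\<lambda>n. d * (ln (orbit_norm (Suc n) x) / real d ^ Suc n)) \<longlonglongrightarrow> d * G x"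
    using LIMSEQ_Suc[OF G_tendsto(1)[of x]] by (intro tendsto_intros)
  ultimately have "(\<lambda>n. ln (orbit_norm n (H x)) / real d ^ n) \<longlonglongrightarrow> d * G x" by simp
  from LIMSEQ_unique[OF G_tendsto(1) this] show ?thesis .
qed

text \<open>Where \<open>cmod w \<le> cmod z\<close> and \<open>z\<close> is large, the leading term
  of \<open>p\<close> dominates, and \<open>H\<close> preserves this region. The first coordinate
  then grows at least like \<open>2 ^ (d ^ n)\<close>, which forces \<open>G \<ge> ln 2\<close> at
  the starting point.\<close>

lemma ex_G_pos: "\<exists>x. G x > 0"
proof -
  let ?a = "lead_coeff p"
  have a: "cmod ?a > 0" using degree_ge_2 by auto
  \<comment> \<open>Half the leading coefficient survives the lower order terms; the cap 1 gives
    \<open>c ^ d \<le> c ^ 2\<close> later.\<close>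
  define c where "c = min 1 (cmod ?a / 2)"
  have c: "c > 0" "c \<le> 1" "c \<le> cmod ?a / 2" using a by (auto simp: c_def)
  \<comment> \<open>The second entry makes the lower order terms and \<open>\<delta> w\<close> at
    most half the leading term; the third gives \<open>c * R \<ge> 2\<close>, which starts the
    induction.\<close>
  define R where "R = max 2 (max (2 * (coeff_sum + cmod \<delta>) / cmod ?a) (2 / c))"
  have R: "R \<ge> 2" "2 * (coeff_sum + cmod \<delta>) / cmod ?a \<le> R" "2 / c \<le> R" by (auto simp: R_def)
  have grow: "cmod (poly p z + \<delta> * w) \<ge> c * cmod z ^ d"
    if z: "cmod z \<ge> R" and w: "cmod w \<le> cmod z" for z w
  proof -
    have z1: "cmod z \<ge> 1" using z R by simp
    have dd: "Suc (d - 1) = d" using degree_ge_2 by simp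
    have "poly p z = (\<Sum>i<d. coeff p i * z ^ i) + ?a * z ^ d"
      unfolding poly_altdef by (simp add: lessThan_Suc_atMost[symmetric])
    then have e: "?a * z ^ d = poly p z + \<delta> * w - ((\<Sum>i<d. coeff p i * z ^ i) + \<delta> * w)" by simp
    have "cmod (?a * z ^ d) \<le> cmod (poly p z + \<delta> * w) + cmod ((\<Sum>i<d. coeff p i * z ^ i) + \<delta> * w)"
      unfolding e by (rule norm_triangle_ineq4)
    moreover have "cmod ((\<Sum>i<d. coeff p i * z ^ i) + \<delta> * w) \<le> (coeff_sum + cmod \<delta>) * cmod z ^ (d - 1)"
    proof -
      have "cmod (\<Sum>i<d. coeff p i * z ^ i) \<le> (\<Sum>i<d. cmod (coeff p i) * cmod z ^ (d - 1))"
        by (rule order_trans[OF norm_sum], intro sum_mono)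
           (use z1 in \<open>auto simp: norm_mult norm_power intro!: mult_left_mono power_increasing\<close>)
      also have "\<dots> \<le> coeff_sum * cmod z ^ (d - 1)"
        unfolding coeff_sum_def sum_distrib_right[symmetric] by (intro mult_right_mono sum_mono2) auto
      finally have "cmod (\<Sum>i<d. coeff p i * z ^ i) \<le> coeff_sum * cmod z ^ (d - 1)" .
      moreover have "cmod (\<delta> * w) \<le> cmod \<delta> * cmod z ^ (d - 1)"
      proof -
        have "cmod z ^ 1 \<le> cmod z ^ (d - 1)"
          using z1 degree_ge_2 by (intro power_increasing) auto
        then show ?thesis using w by (simp add: norm_mult mult_left_mono)
      qed
      ultimately show ?thesis by (intro norm_triangle_le) (simp add: distrib_right)
    qed
    moreover have "(coeff_sum + cmod \<delta>) * cmod z ^ (d - 1) \<le> cmod ?a / 2 * cmod z ^ d"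
    proof -
      have "coeff_sum + cmod \<delta> \<le> cmod ?a / 2 * cmod z"
        using order_trans[OF R(2) z] a by (simp add: pos_divide_le_eq mult.commute)
      then have "(coeff_sum + cmod \<delta>) * cmod z ^ (d - 1) \<le> (cmod ?a / 2 * cmod z) * cmod z ^ (d - 1)"
        by (intro mult_right_mono) auto
      also have "\<dots> = cmod ?a / 2 * cmod z ^ Suc (d - 1)" by simp
      finally show ?thesis unfolding dd .
    qed
    moreover have "c * cmod z ^ d \<le> cmod ?a / 2 * cmod z ^ d"
      using c by (intro mult_right_mono) auto
    ultimately show ?thesis by (simp add: norm_mult norm_power)
  qed
  define x :: c2 where "x = (complex_of_real R, 0)"
  \<comment> \<open>The first two conjuncts keep the orbit where \<open>grow\<close> applies. The
    third reproduces itself because \<open>(c * t) ^ d \<le> c * (c * t ^ d)\<close> for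
    \<open>t \<ge> 0\<close>.\<close>
  have it: "cmod (fst ((H ^^ n) x)) \<ge> R \<and> cmod (snd ((H ^^ n) x)) \<le> cmod (fst ((H ^^ n) x))
      \<and> c * cmod (fst ((H ^^ n) x)) \<ge> 2 ^ (d ^ n)" for n
  proof (induction n)
    case 0
    have "2 \<le> R * c" using R(3) c(1) by (simp add: pos_divide_le_eq)
    then show ?case using R(1) by (simp add: x_def mult.commute)
  next
    case (Suc n)
    define y where "y = (H ^^ n) x"
    have y: "cmod (fst y) \<ge> R" "cmod (snd y) \<le> cmod (fst y)" "c * cmod (fst y) \<ge> 2 ^ (d ^ n)"
      using Suc unfolding y_def by auto
    have g: "cmod (fst (H y)) \<ge> c * cmod (fst y) ^ d" using grow y by simp
    have "2 \<le> c * cmod (fst y)"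
      using y(3) power_increasing[of 1 "d ^ n" "2::real"] degree_ge_2 by simp
    moreover have "cmod (fst y) ^ 1 \<le> cmod (fst y) ^ (d - 1)"
      using R y degree_ge_2 by (intro power_increasing) auto
    moreover have "cmod (fst y) ^ d = cmod (fst y) ^ (d - 1) * cmod (fst y)"
      using degree_ge_2 by (cases d) auto
    ultimately have "2 * cmod (fst y) \<le> c * cmod (fst y) ^ d"
    proof -
      assume 1: "2 \<le> c * cmod (fst y)" "cmod (fst y) ^ 1 \<le> cmod (fst y) ^ (d - 1)"
        and 2: "cmod (fst y) ^ d = cmod (fst y) ^ (d - 1) * cmod (fst y)"
      have "2 * cmod (fst y) \<le> (c * cmod (fst y)) * cmod (fst y) ^ (d - 1)"
        using 1 by (intro mult_mono) auto
      then show ?thesis unfolding 2 by (simp add: mult_ac)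
    qed
    with g have "cmod (fst (H y)) \<ge> cmod (fst y)" using norm_ge_zero[of "fst y"] by linarith
    moreover have "2 ^ (d ^ Suc n) \<le> c * cmod (fst (H y))"
    proof -
      have "(2::real) ^ (d ^ Suc n) = (2 ^ (d ^ n)) ^ d"
        by (simp add: power_mult[symmetric] mult.commute)
      also have "\<dots> \<le> (c * cmod (fst y)) ^ d" using y by (intro power_mono) auto
      also have "\<dots> = c ^ d * cmod (fst y) ^ d" by (rule power_mult_distrib)
      also have "\<dots> \<le> c ^ 2 * cmod (fst y) ^ d"
        using c degree_ge_2 by (intro mult_right_mono power_decreasing) auto
      also have "\<dots> = c * (c * cmod (fst y) ^ d)" by (simp add: power2_eq_square)
      also have "\<dots> \<le> c * cmod (fst (H y))" using g c by (intro mult_left_mono) auto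
      finally show ?thesis .
    qed
    ultimately show ?case using y by (simp add: y_def del: H_simps(1))
  qed
  have "ln 2 \<le> ln (orbit_norm n x) / real d ^ n" for n
  proof -
    let ?z = "cmod (fst ((H ^^ n) x))"
    have "2 ^ (d ^ n) \<le> c * ?z" using it by blast
    also have "\<dots> \<le> 1 * ?z" using c by (intro mult_right_mono) auto
    also have "\<dots> \<le> orbit_norm n x" using norm_fst_le[of "fst ((H ^^ n) x)" "snd ((H ^^ n) x)"] by (simp add: orbit_norm_def)
    finally have "ln (2 ^ (d ^ n)) \<le> ln (orbit_norm n x)" using orbit_norm_ge_1[of n x] by (subst ln_le_cancel_iff) auto
    then have "d ^ n * ln 2 \<le> ln (orbit_norm n x)" by (simp add: ln_realpow)
    then show ?thesis using degree_ge_2 by (simp add: pos_le_divide_eq mult.commute)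
  qed
  then have "ln 2 \<le> G x" by (intro LIMSEQ_le_const[OF G_tendsto(1)]) auto
  then show ?thesis by (intro exI[of _ x]) (smt (verit) ln_gt_zero)
qed

section \<open>Sublevel sets are Short domains\<close>

text \<open>The assumption makes the radius \<open>exp (d ^ n * r) / K\<close> exceed 1, so the
  truncation in \<open>orbit_norm\<close> does not affect the inequality.\<close>

lemma sublevel_green_approx_eq:
  fixes r :: real
  assumes "exp (d ^ n * r) > K"
  shows "{x. green_approx n x < r} = (\<lambda>x. (K / exp (d ^ n * r)) *\<^sub>R (H ^^ n) x) -` ball 0 1"
proof -
  have "green_approx n x < r \<longleftrightarrow> norm ((H ^^ n) x) < exp (d ^ n * r) / K" for x
  proof -
    have "1 < exp (d ^ n * r) / K" using assms K_ge_1 by (simp add: pos_less_divide_eq)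
    then show ?thesis unfolding green_approx_less_iff orbit_norm_def by simp
  qed
  moreover have "y < exp (d ^ n * r) / K \<longleftrightarrow> K / exp (d ^ n * r) * y < 1" for y
    using K_ge_1 by (simp add: pos_less_divide_eq pos_divide_less_eq mult.commute)
  ultimately show ?thesis using K_ge_1 by (simp add: vimage_def)
qed

lemma sublevel_green_approx_ball:
  fixes r :: real
  assumes "exp (d ^ n * r) > K"
  shows "c2_domain {x. green_approx n x < r}" "biholomorphic {x. green_approx n x < r} unit_ball2"
proof -
  have "c2_automorphism (\<lambda>x. (K / exp (d ^ n * r)) *\<^sub>R (H ^^ n) x)"
    using K_ge_1 by (intro c2_automorphism_comp[OF c2_automorphism_iterate c2_automorphism_scale]) auto
  moreover have "c2_domain (ball 0 1)" unfolding c2_domain_def by auto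
  ultimately show "c2_domain {x. green_approx n x < r}" "biholomorphic {x. green_approx n x < r} unit_ball2"
    unfolding sublevel_green_approx_eq[OF assms] unit_ball2_def
    by (auto intro: c2_domain_c2_automorphism_vimage biholomorphic_c2_automorphism_vimage)
qed

lemma ball_exhaustion:
  assumes "r > 0"
  obtains D :: "nat \<Rightarrow> c2 set" where "\<And>n. D n \<subseteq> D (Suc n)"
    "\<And>n. c2_domain (D n)" "\<And>n. biholomorphic (D n) unit_ball2" "(\<Union>n. D n) = {x. G x < r}"
proof -
  obtain N where N: "\<And>n. n \<ge> N \<Longrightarrow> K < exp (real d ^ n * r)"
    using exp_power_unbounded[OF degree_ge_2 assms] by blast
  define D where "D = (\<lambda>n. {x. green_approx (N + n) x < r})"
  have "D n \<subseteq> D (Suc n)" for n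
    unfolding D_def using green_approx_Suc_le by (auto intro: le_less_trans)
  moreover have "c2_domain (D n)" "biholomorphic (D n) unit_ball2" for n
    unfolding D_def using sublevel_green_approx_ball[of "N + n" r] N by auto
  moreover have "(\<Union>n. D n) = {x. G x < r}"
  proof -
    have "\<exists>n. green_approx (N + n) x < r" if "green_approx n x < r" for n x
      using decseqD[OF green_approx_decseq, of n "N + n" x] that by (intro exI[of _ n]) simp
    then show ?thesis unfolding D_def G_less_iff by blast
  qed
  ultimately show thesis using that by blast
qed

lemma c2_domain_G_less:
  assumes "r > 0"
  shows "c2_domain {x. G x < r}"
proof -
  obtain D :: "nat \<Rightarrow> c2 set" where D: "\<And>n. D n \<subseteq> D (Suc n)" "\<And>n. c2_domain (D n)"
    "\<And>n. biholomorphic (D n) unit_ball2" "(\<Union>n. D n) = {x. G x < r}"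
    by (rule ball_exhaustion[OF assms]) blast
  obtain x where x: "x \<in> D 0" using D(2) unfolding c2_domain_def by blast
  have "x \<in> D n" for n using x D(1) by (induction n) auto
  then have "connected (\<Union>n. D n)"
    using D(2) unfolding c2_domain_def by (intro connected_Union) auto
  moreover have "(\<Union>n. D n) \<noteq> {}" using x by blast
  ultimately show ?thesis using open_G_less unfolding c2_domain_def D(4) by blast
qed

text \<open>The disc is the image of an affine disc in direction \<open>\<mu> *\<^sub>R D v\<close>
  under the inverse \<open>g\<close> of \<open>H ^^ n\<close>. The chain rule gives
  \<open>E (D v) = v\<close>, so its derivative at the origin is exactly
  \<open>\<mu> *\<^sub>R v\<close>.\<close>

lemma kobayashi_royden_G_less:
  assumes "G x < r"
  shows "kobayashi_royden {x. G x < r} x v = 0"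
proof (rule kobayashi_royden_eq_0)
  fix \<mu> :: real assume \<mu>: "\<mu> > 0"
  obtain s where s: "G x < s" "s < r" using dense[OF assms] by blast
  obtain N where N: "green_approx N x < s" using s G_less_iff by blast
  obtain e where e: "e > 0" "ball x e \<subseteq> {x. green_approx N x < s}"
    using open_green_approx_less[of N s] N open_contains_ball by (metis (mono_tags, lifting) mem_Collect_eq)
  \<comment> \<open>The summand 1 avoids a division by zero when \<open>v = 0\<close>, and the
    factor 2 keeps the line segment strictly inside the ball.\<close>
  define \<rho> where "\<rho> = e / (2 * (norm v + 1))"
  have \<rho>: "\<rho> > 0" using e by (simp add: \<rho>_def add_nonneg_pos)
  have \<rho>v: "\<rho> * norm v < e"
  proof -
    have "norm v + 1 > 0" by (intro add_nonneg_pos) auto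
    then have "2 * (norm v + 1) \<noteq> 0" by simp
    then have "\<rho> * (2 * (norm v + 1)) = e" using nonzero_eq_divide_eq \<rho>_def by blast
    moreover have "\<rho> * (2 * (norm v + 1)) = 2 * (\<rho> * norm v) + 2 * \<rho>" by (simp add: algebra_simps)
    moreover have "0 \<le> \<rho> * norm v" using \<rho> by simp
    ultimately show ?thesis using \<rho> by linarith
  qed
  \<comment> \<open>The gap between \<open>s\<close> and \<open>r\<close> absorbs both
    \<open>K\<close> and the radius of the affine disc.\<close>
  obtain N' where N': "\<And>n. n \<ge> N' \<Longrightarrow> K * (1 + 2 * \<mu> / \<rho>) < exp (real d ^ n * (r - s))"
    using exp_power_unbounded[OF degree_ge_2, of "r - s"] s by auto
  define n where "n = max N N'"
  define B where "B = exp (d ^ n * s)"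
  have B: "norm ((H ^^ n) (x + \<zeta> *\<^sub>C v)) \<le> B" if "cmod \<zeta> \<le> \<rho>" for \<zeta>
  proof -
    have "norm (\<zeta> *\<^sub>C v) \<le> \<rho> * norm v" using that unfolding norm_cscale by (intro mult_right_mono) auto
    then have "x + \<zeta> *\<^sub>C v \<in> ball x e" using \<rho>v by (simp add: dist_norm)
    then have "green_approx N (x + \<zeta> *\<^sub>C v) < s" using e by blast
    then have "green_approx n (x + \<zeta> *\<^sub>C v) < s"
      using decseqD[OF green_approx_decseq, of N n "x + \<zeta> *\<^sub>C v"] by (simp add: n_def)
    then have "orbit_norm n (x + \<zeta> *\<^sub>C v) < B / K" unfolding green_approx_less_iff B_def .
    also have "\<dots> \<le> B" using K_ge_1 by (simp add: B_def pos_divide_le_eq)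
    finally show ?thesis by (simp add: orbit_norm_def)
  qed
  obtain g where g: "c2_holomorphic_on g UNIV" "\<And>x. g ((H ^^ n) x) = x" "\<And>x. (H ^^ n) (g x) = x"
    using c2_automorphism_iterate unfolding c2_automorphism_def by blast
  obtain D where D: "((H ^^ n) has_derivative D) (at x)" "\<forall>c v. D (c *\<^sub>C v) = c *\<^sub>C D v"
    using c2_holomorphic_iterate unfolding c2_holomorphic_on_def by blast
  define y where "y = (H ^^ n) x"
  obtain E where E: "(g has_derivative E) (at y)" "\<forall>c v. E (c *\<^sub>C v) = c *\<^sub>C E v"
    using g(1) unfolding c2_holomorphic_on_def by blast
  have "((\<lambda>x. g ((H ^^ n) x)) has_derivative (\<lambda>v. E (D v))) (at x)"
    using has_derivative_compose[OF D(1)] E(1) unfolding y_def by blast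
  moreover have "((\<lambda>x. g ((H ^^ n) x)) has_derivative (\<lambda>v. v)) (at x)"
    unfolding g(2) by (rule has_derivative_ident)
  ultimately have ED: "E (D v) = v" using has_derivative_unique by metis
  have D': "(((H ^^ n)) has_derivative D) (at (x + 0 *\<^sub>C v))" using D(1) by simp
  have cauchy: "cmod (deriv f 0) \<le> B / \<rho>"
    if "f holomorphic_on UNIV" "\<And>\<zeta>. cmod \<zeta> \<le> \<rho> \<Longrightarrow> cmod (f \<zeta>) \<le> B" for f
  proof -
    have "norm ((deriv ^^ 1) f 0) \<le> fact 1 * B / \<rho> ^ 1"
      using that \<rho>
      by (intro Cauchy_inequality) (auto intro: holomorphic_on_subset holomorphic_on_imp_continuous_on)
    then show ?thesis by simp
  qed
  have "cmod (fst (D v)) \<le> B / \<rho>"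
    unfolding DERIV_imp_deriv[OF c2_holomorphic_on_line(1)[OF D' D(2)], symmetric]
  proof (rule cauchy[OF holomorphic_on_line(1)[OF c2_holomorphic_iterate]])
    show "cmod (fst ((H ^^ n) (x + \<zeta> *\<^sub>C v))) \<le> B" if "cmod \<zeta> \<le> \<rho>" for \<zeta>
      using B[OF that] cmod_fst_le by (rule order_trans[rotated])
  qed
  moreover have "cmod (snd (D v)) \<le> B / \<rho>"
    unfolding DERIV_imp_deriv[OF c2_holomorphic_on_line(2)[OF D' D(2)], symmetric]
  proof (rule cauchy[OF holomorphic_on_line(2)[OF c2_holomorphic_iterate]])
    show "cmod (snd ((H ^^ n) (x + \<zeta> *\<^sub>C v))) \<le> B" if "cmod \<zeta> \<le> \<rho>" for \<zeta>
      using B[OF that] cmod_snd_le by (rule order_trans[rotated])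
  qed
  ultimately have Dv: "norm (D v) \<le> 2 * B / \<rho>" using norm_c2_le[of "D v"] by simp
  define f where "f = (\<lambda>\<zeta>. g (y + \<zeta> *\<^sub>C (\<mu> *\<^sub>R D v)))"
  have y0: "y + 0 *\<^sub>C (\<mu> *\<^sub>R D v) = y" by simp
  have "disc_holomorphic f"
    unfolding disc_holomorphic_def f_def using holomorphic_on_line[OF g(1)] by blast
  moreover have "f 0 = x" unfolding f_def y0 by (simp add: y_def g)
  moreover have "disc_deriv0 f = \<mu> *\<^sub>R v"
  proof -
    have "E (\<mu> *\<^sub>R D v) = \<mu> *\<^sub>R v" using E(2) ED by (simp add: scaleR_eq_cscale del: split_paired_All)
    then show ?thesis
      using DERIV_imp_deriv[OF c2_holomorphic_on_line(1)[of g E y 0, OF _ E(2)], of "\<mu> *\<^sub>R D v"]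
        DERIV_imp_deriv[OF c2_holomorphic_on_line(2)[of g E y 0, OF _ E(2)], of "\<mu> *\<^sub>R D v"] E(1)
      unfolding disc_deriv0_def f_def y0 by (simp add: prod_eq_iff)
  qed
  moreover have "f ` ball 0 1 \<subseteq> {x. G x < r}"
  proof clarsimp
    fix \<zeta> assume \<zeta>: "cmod \<zeta> < 1"
    have x: "x + 0 *\<^sub>C v = x" by simp
    have "norm ((H ^^ n) (f \<zeta>)) \<le> norm y + norm (\<zeta> *\<^sub>C (\<mu> *\<^sub>R D v))"
      unfolding f_def g by (rule norm_triangle_ineq)
    also have "norm y \<le> B" using B[of 0] \<rho> unfolding x y_def by simp
    also have "norm (\<zeta> *\<^sub>C (\<mu> *\<^sub>R D v)) \<le> 1 * (\<mu> * (2 * B / \<rho>))"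
      unfolding norm_cscale norm_scaleR using \<zeta> \<mu> Dv by (intro mult_mono) auto
    finally have a: "norm ((H ^^ n) (f \<zeta>)) \<le> B * (1 + 2 * \<mu> / \<rho>)" by (simp add: algebra_simps)
    have b: "B * (1 + 2 * \<mu> / \<rho>) < exp (d ^ n * r) / K"
    proof -
      have "K * (1 + 2 * \<mu> / \<rho>) < exp (d ^ n * (r - s))" using N'[of n] by (simp add: n_def)
      then have "B * (K * (1 + 2 * \<mu> / \<rho>)) < B * exp (d ^ n * (r - s))" by (simp add: B_def)
      also have "\<dots> = exp (d ^ n * r)" by (simp add: B_def exp_add[symmetric] algebra_simps)
      finally show ?thesis using K_ge_1 by (simp add: pos_less_divide_eq mult_ac)
    qed
    \<comment> \<open>Needed because \<open>orbit_norm\<close> is a maximum with 1.\<close>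
    have "1 \<le> B * (1 + 2 * \<mu> / \<rho>)"
    proof -
      have "s > 0" using s(1) G_nonneg[of x] by simp
      then have "B \<ge> 1" by (simp add: B_def)
      then show ?thesis using \<mu> \<rho> mult_mono[of 1 B 1 "1 + 2 * \<mu> / \<rho>"] by simp
    qed
    then have "orbit_norm n (f \<zeta>) < exp (d ^ n * r) / K" using a b by (simp add: orbit_norm_def)
    then show "G (f \<zeta>) < r" using G_less_iff green_approx_less_iff by blast
  qed
  ultimately show "\<exists>f. disc_holomorphic f \<and> f ` ball 0 1 \<subseteq> {x. G x < r} \<and> f 0 = x \<and> disc_deriv0 f = \<mu> *\<^sub>R v"
    by blast
qed

text \<open>Pairing \<open>(H ^^ n)\<close> with the unit vector in the direction of
  \<open>(H ^^ n) a\<close> gives a holomorphic function bounded by the norm, with equality at the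
  centre. The scalar estimate \<open>cmod_le_exp_circle_mean\<close> then applies.\<close>

lemma green_approx_submean:
  assumes r: "r > 0"
  shows "green_approx n a \<le> 1 / (2 * pi) * integral {0..2*pi}
    (\<lambda>\<theta>. green_approx n (a + (complex_of_real r * exp (\<i> * complex_of_real \<theta>)) *\<^sub>C b))"
proof -
  define c where "c = (\<lambda>\<theta>. a + (complex_of_real r * exp (\<i> * complex_of_real \<theta>)) *\<^sub>C b)"
  define g where "g = (\<lambda>\<theta>. ln (orbit_norm n (c \<theta>)))"
  have cont: "continuous_on UNIV (\<lambda>\<theta>. (H ^^ n) (c \<theta>))"
    unfolding c_def by (intro continuous_intros continuous_on_compose2[OF continuous_iterate]) auto
  have gcont: "continuous_on UNIV g"
    unfolding g_def orbit_norm_def by (intro continuous_intros cont) (auto simp: max_def)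
  have gint: "g integrable_on {0..2*pi}"
    using gcont by (intro integrable_continuous_real) (auto intro: continuous_on_subset)
  have exp_g: "exp (g \<theta>) = orbit_norm n (c \<theta>)" for \<theta>
    unfolding g_def using orbit_norm_ge_1[of n "c \<theta>"] by simp
  have "exp (\<i> * complex_of_real (\<theta> + 2 * pi)) = exp (\<i> * complex_of_real \<theta>)" for \<theta>
    unfolding cis_conv_exp[symmetric] by (simp add: complex_eq_iff)
  then have per: "g (\<theta> + 2 * pi) = g \<theta>" for \<theta>
    unfolding g_def c_def by simp
  let ?M = "1 / (2 * pi) * integral {0..2*pi} g"
  \<comment> \<open>If \<open>(H ^^ n) a = 0\<close>, then \<open>u = 0\<close> and only
    \<open>norm u \<le> 1\<close> remains true, which suffices.\<close>
  define u where "u = (H ^^ n) a /\<^sub>R norm ((H ^^ n) a)"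
  have u: "norm u \<le> 1" by (cases "(H ^^ n) a = 0") (simp_all add: u_def)
  have pair: "cmod (cnj (fst u) * fst y + cnj (snd u) * snd y) \<le> norm y" for y :: c2
    using cmod_cnj_pairing_le[of u y] mult_right_mono[OF u norm_ge_zero[of y]] by simp
  define f where "f = (\<lambda>\<zeta>. cnj (fst u) * fst ((H ^^ n) (a + \<zeta> *\<^sub>C b)) + cnj (snd u) * snd ((H ^^ n) (a + \<zeta> *\<^sub>C b)))"
  have "cmod (f 0) \<le> exp ?M"
  proof (rule cmod_le_exp_circle_mean[OF _ r gcont per])
    show "f holomorphic_on UNIV"
      unfolding f_def by (intro holomorphic_intros holomorphic_on_line c2_holomorphic_iterate)
    show "cmod (f (complex_of_real r * exp (\<i> * complex_of_real \<theta>))) \<le> exp (g \<theta>)" for \<theta>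
      unfolding exp_g orbit_norm_def f_def c_def using pair by (intro max.coboundedI2)
  qed
  moreover have "norm ((H ^^ n) a) = cmod (f 0)"
  proof -
    have "f 0 = cnj (fst u) * fst ((H ^^ n) a) + cnj (snd u) * snd ((H ^^ n) a)"
      by (simp add: f_def)
    also have "\<dots> = complex_of_real ((cmod (fst ((H ^^ n) a)))\<^sup>2 + (cmod (snd ((H ^^ n) a)))\<^sup>2) / norm ((H ^^ n) a)"
      unfolding u_def by (simp add: scaleR_conv_of_real complex_norm_square[symmetric] field_simps add_divide_distrib flip: of_real_power)
    also have "(cmod (fst ((H ^^ n) a)))\<^sup>2 + (cmod (snd ((H ^^ n) a)))\<^sup>2 = (norm ((H ^^ n) a))\<^sup>2"
      by (simp add: norm_prod_def)
    finally show ?thesis by (simp add: power2_eq_square norm_mult norm_divide)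
  qed
  \<comment> \<open>This covers the case where the maximum in \<open>orbit_norm n a\<close> is
    1.\<close>
  moreover have "0 \<le> ?M"
  proof -
    have "0 \<le> integral {0..2*pi} g" using orbit_norm_ge_1 by (intro integral_nonneg gint) (simp add: g_def)
    then show ?thesis by simp
  qed
  ultimately have "orbit_norm n a \<le> exp ?M" unfolding orbit_norm_def by simp
  then have "ln (orbit_norm n a) \<le> ln (exp ?M)" using orbit_norm_ge_1[of n a] by (subst ln_le_cancel_iff) auto
  then have "ln (orbit_norm n a) \<le> ?M" by (simp only: ln_exp)
  moreover have "integral {0..2*pi} (\<lambda>\<theta>. green_approx n (c \<theta>)) = (integral {0..2*pi} g + 2 * pi * ln K) / d ^ n"
  proof -
    have "green_approx n (c \<theta>) = (g \<theta> + ln K) / d ^ n" for \<theta> by (simp add: green_approx_def g_def)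
    moreover have "integral {0..2*pi} (\<lambda>\<theta>. g \<theta> + ln K) = integral {0..2*pi} g + 2 * pi * ln K"
      using gint by (subst Henstock_Kurzweil_Integration.integral_add) auto
    ultimately show ?thesis by simp
  qed
  ultimately show ?thesis
    unfolding green_approx_def[of n a] using degree_ge_2 by (simp add: c_def field_simps)
qed

text \<open>The submean inequality of the approximations passes to the limit by dominated
  convergence, with \<open>green_approx 0\<close> as dominating function.\<close>

lemma plurisubharmonic_G: "plurisubharmonic_on \<Omega> (\<lambda>x. ereal (G x))" if "open \<Omega>"
  unfolding plurisubharmonic_on_def
proof (intro conjI allI impI ballI)
  fix c :: ereal
  have "open {x. ereal (G x) < c}" using open_G_less by (cases c) auto
  then have "open (\<Omega> \<inter> {x. ereal (G x) < c})" using that by auto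
  then show "open {x \<in> \<Omega>. ereal (G x) < c}" by (simp add: Collect_conj_eq)
next
  fix a b :: c2 and r :: real assume r: "r > 0"
  define c where "c = (\<lambda>\<theta>. a + (complex_of_real r * exp (\<i> * complex_of_real \<theta>)) *\<^sub>C b)"
  define I where "I = {0..2*pi}"
  have ccont: "continuous_on UNIV c" unfolding c_def by (intro continuous_intros)
  have hcont: "continuous_on UNIV (\<lambda>\<theta>. green_approx n (c \<theta>))" for n
    by (rule continuous_on_compose2[OF continuous_green_approx ccont]) auto
  have hint: "set_integrable lborel I (\<lambda>\<theta>. green_approx n (c \<theta>))" for n
    unfolding I_def by (intro borel_integrable_atLeastAtMost') (auto intro: continuous_on_subset[OF hcont])
  have hmeas: "(\<lambda>\<theta>. green_approx n (c \<theta>)) \<in> borel_measurable borel" for n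
    by (rule borel_measurable_continuous_onI[OF hcont])
  have Gmeas: "(\<lambda>\<theta>. G (c \<theta>)) \<in> borel_measurable borel"
    by (rule borel_measurable_LIMSEQ_real[OF G_tendsto(2) hmeas])
  have Gint: "set_integrable lborel I (\<lambda>\<theta>. G (c \<theta>))"
    unfolding set_integrable_def
  proof (rule Bochner_Integration.integrable_bound[OF hint[of 0, unfolded set_integrable_def]])
    show "(\<lambda>\<theta>. indicator I \<theta> *\<^sub>R G (c \<theta>)) \<in> borel_measurable lborel"
      using Gmeas by (simp add: I_def)
    show "AE \<theta> in lborel. norm (indicator I \<theta> *\<^sub>R G (c \<theta>)) \<le> norm (indicator I \<theta> *\<^sub>R green_approx 0 (c \<theta>))"
      using G_nonneg green_approx_nonneg G_le_green_approx by (auto simp: indicator_def abs_of_nonneg)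
  qed
  have "(\<lambda>n. LINT \<theta>:I|lborel. green_approx n (c \<theta>)) \<longlonglongrightarrow> (LINT \<theta>:I|lborel. G (c \<theta>))"
    unfolding set_lebesgue_integral_def
  proof (rule integral_dominated_convergence[where w = "\<lambda>\<theta>. indicator I \<theta> *\<^sub>R green_approx 0 (c \<theta>)"])
    show "(\<lambda>\<theta>. indicator I \<theta> *\<^sub>R G (c \<theta>)) \<in> borel_measurable lborel"
      using Gmeas by (simp add: I_def)
    show "(\<lambda>\<theta>. indicator I \<theta> *\<^sub>R green_approx n (c \<theta>)) \<in> borel_measurable lborel" for n
      using hmeas by (simp add: I_def)
    show "integrable lborel (\<lambda>\<theta>. indicator I \<theta> *\<^sub>R green_approx 0 (c \<theta>))"
      using hint[of 0] unfolding set_integrable_def .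
    show "AE \<theta> in lborel. (\<lambda>n. indicator I \<theta> *\<^sub>R green_approx n (c \<theta>)) \<longlonglongrightarrow> indicator I \<theta> *\<^sub>R G (c \<theta>)"
      by (intro AE_I2 tendsto_intros G_tendsto(2))
    show "AE \<theta> in lborel. norm (indicator I \<theta> *\<^sub>R green_approx n (c \<theta>)) \<le> indicator I \<theta> *\<^sub>R green_approx 0 (c \<theta>)" for n
      using decseqD[OF green_approx_decseq, of 0 n] green_approx_nonneg by (auto simp: indicator_def abs_of_nonneg)
  qed
  moreover have "2 * pi * G a \<le> (LINT \<theta>:I|lborel. green_approx n (c \<theta>))" for n
  proof -
    have "G a \<le> 1 / (2 * pi) * integral I (\<lambda>\<theta>. green_approx n (c \<theta>))"
      using G_le_green_approx green_approx_submean[OF r] unfolding c_def I_def by (rule order_trans)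
    then show ?thesis
      using set_borel_integral_eq_integral(2)[OF hint[of n]] by (simp add: field_simps)
  qed
  ultimately have "2 * pi * G a \<le> (LINT \<theta>:I|lborel. G (c \<theta>))"
    by (intro LIMSEQ_le_const) auto
  then have "G a \<le> 1 / (2 * pi) * (LINT \<theta>:I|lborel. G (c \<theta>))"
    by (simp add: field_simps)
  then show "ereal (G a) \<le> circle_mean (\<lambda>x. ereal (G x)) a b r"
    using circle_mean_nonneg_eq[of G a r b] G_nonneg Gint unfolding c_def I_def by simp
qed auto

text \<open>The inverse of \<open>H\<close> divides \<open>G\<close> by \<open>d\<close>. Pulling a
  point with \<open>G > 0\<close> back often enough brings its value below \<open>r\<close>, and one
  more pullback changes it.\<close>

lemma G_nonconstant:
  assumes "r > 0"
  obtains x y where "G x < r" "G y < r" "G x \<noteq> G y"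
proof -
  obtain g where g: "\<And>x. H (g x) = x" using c2_automorphism_H unfolding c2_automorphism_def by blast
  have Gg: "G (g x) = G x / d" for x
    using G_H[of "g x"] degree_ge_2 by (simp add: g field_simps)
  obtain x0 where x0: "G x0 > 0" using ex_G_pos by blast
  have it: "G ((g ^^ k) x0) = G x0 / d ^ k" for k
    by (induction k) (simp_all add: Gg field_simps)
  obtain k :: nat where "G x0 / r < k" using reals_Archimedean2 by blast
  also have "real k < 2 ^ k" by (rule of_nat_less_two_power)
  also have "\<dots> \<le> real d ^ k" using degree_ge_2 by (intro power_mono) auto
  finally have k: "G x0 / d ^ k < r"
    using assms degree_ge_2 by (simp add: field_simps)
  define x where "x = (g ^^ k) x0"
  have x: "0 < G x" "G x < r" using k x0 degree_ge_2 unfolding x_def it by auto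
  have "G x / d < G x" using x degree_ge_2 by (simp add: pos_divide_less_eq)
  then show thesis using that[of x "g x"] x unfolding Gg by simp
qed

lemma short_C2_G_less:
  assumes "r > 0"
  shows "short_C2 {x. G x < r}"
  unfolding short_C2_def
proof (intro conjI)
  show "c2_domain {x. G x < r}" by (rule c2_domain_G_less[OF assms])
  show "\<exists>D :: nat \<Rightarrow> c2 set. (\<forall>n. D n \<subseteq> D (Suc n)) \<and> (\<forall>n. c2_domain (D n) \<and> biholomorphic (D n) unit_ball2)
        \<and> (\<Union>n. D n) = {x. G x < r}"
    by (rule ball_exhaustion[OF assms]) blast
  show "\<forall>x\<in>{x. G x < r}. \<forall>v. kobayashi_royden {x. G x < r} x v = 0"
    using kobayashi_royden_G_less by blast
  obtain x y where "G x < r" "G y < r" "G x \<noteq> G y" using G_nonconstant[OF assms] by blast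
  then show "\<exists>u. plurisubharmonic_on {x. G x < r} u \<and> (\<exists>M::real. \<forall>x\<in>{x. G x < r}. u x \<le> ereal M) \<and>
          (\<exists>x\<in>{x. G x < r}. \<exists>y\<in>{x. G x < r}. u x \<noteq> u y)"
    using plurisubharmonic_G[OF open_G_less]
    by (intro exI[of _ "\<lambda>x. ereal (G x)"] conjI exI[of _ r] bexI[of _ x] bexI[of _ y]) auto
qed

section \<open>Sublevel sets are Loewner\<close>

text \<open>The factor \<open>3 * K\<close> puts the polydiscs with radii \<open>a\<^bsub>N+1\<^esub>\<close> and \<open>2 a\<^sub>N\<close> into the ball of radius
  \<open>exp (d ^ (N + 1) * r) / K\<close>; the factor \<open>2 ^ d\<close> pays for the doubling of the first radius in a stage.\<close>

definition Q :: real where "Q = 3 * K * 2 ^ d"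

definition radius :: "real \<Rightarrow> nat \<Rightarrow> real" where "radius r N = exp (real d ^ N * r) / Q"

definition fst_radius :: "real \<Rightarrow> nat \<Rightarrow> real \<Rightarrow> real" where
  "fst_radius r N s = (1 + s) * radius r (Suc N)"

text \<open>Linear in \<open>s\<close>. The factor \<open>cmod \<delta>\<close> offsets the
  \<open>\<delta>\<close> of the shear, so \<open>s = 0\<close> bounds \<open>w\<close> itself by
  \<open>2 * radius r N\<close>.\<close>

definition snd_radius :: "real \<Rightarrow> nat \<Rightarrow> real \<Rightarrow> real" where
  "snd_radius r N s = (1 - s) * (2 * cmod \<delta> * radius r N) + s * radius r (Suc (Suc N))"

text \<open>For \<open>s = 0\<close> the set \<open>gauge2 (stage r N s x) < 1\<close> is the preimage of the polydisc with radii
  \<open>radius r (N + 1)\<close> and \<open>2 * radius r N\<close> under \<open>H ^^ (N + 1)\<close>, and for \<open>s = 1\<close> it is the same set with \<open>N + 1\<close>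
  in place of \<open>N\<close>.\<close>

definition stage :: "real \<Rightarrow> nat \<Rightarrow> real \<Rightarrow> c2 \<Rightarrow> c2" where
  "stage r N s x = (let y = (H ^^ Suc N) x in
     (fst y / complex_of_real (fst_radius r N s),
      (\<delta> * snd y + complex_of_real s * poly p (fst y)) / complex_of_real (snd_radius r N s)))"

lemma Q_ge: "Q \<ge> 3 * K" "Q \<ge> 1" "Q > (coeff_sum + cmod \<delta>) * 2 ^ d"
proof -
  have "(1::real) \<le> 2 ^ d" by simp
  then have "3 * K * 1 \<le> 3 * K * 2 ^ d" using K_ge_1 by (intro mult_left_mono) auto
  then show "Q \<ge> 3 * K" by (simp add: Q_def)
  then show "Q \<ge> 1" using K_ge_1 by linarith
  have "(coeff_sum + cmod \<delta>) * 2 ^ d < 3 * K * 2 ^ d"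
    using coeff_sum_nonneg norm_ge_zero[of \<delta>] by (intro mult_strict_right_mono) (simp_all add: K_def add_nonneg_pos)
  then show "Q > (coeff_sum + cmod \<delta>) * 2 ^ d" by (simp add: Q_def)
qed

section \<open>Positivity and growth of the radii\<close>

lemma radius_pos: "radius r N > 0"
  using Q_ge by (simp add: radius_def)

lemma radius_mono: "r > 0 \<Longrightarrow> radius r N \<le> radius r (Suc N)"
  using Q_ge degree_ge_2 by (simp add: radius_def divide_right_mono)

lemma fst_radius_pos: "0 \<le> s \<Longrightarrow> fst_radius r N s > 0"
  using radius_pos by (simp add: fst_radius_def)

lemma snd_radius_pos:
  assumes "0 \<le> s" "s \<le> 1"
  shows "snd_radius r N s > 0"
proof (cases "s = 0")
  case True
  then show ?thesis using radius_pos delta_nonzero by (simp add: snd_radius_def)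
next
  case False
  then show ?thesis using radius_pos[of r N] radius_pos[of r "Suc (Suc N)"] assms
    unfolding snd_radius_def by (intro add_nonneg_pos) auto
qed

text \<open>The right side is the slope of \<open>snd_radius\<close> in \<open>s\<close>; the left
  side bounds \<open>p\<close> on the largest first disc of the stage. In effect
  \<open>radius r (Suc (Suc N))\<close> equals
  \<open>Q ^ (d - 1) * radius r (Suc N) ^ d\<close>.\<close>

lemma radius_growth:
  assumes r: "r > 0" and ge: "radius r (Suc N) \<ge> 1"
  shows "coeff_sum * (2 * radius r (Suc N)) ^ d < radius r (Suc (Suc N)) - 2 * cmod \<delta> * radius r N"
proof -
  let ?A = "radius r (Suc N)"
  have Q: "Q > 0" using Q_ge by simp
  have A1: "?A \<le> ?A ^ d" using ge degree_ge_2 power_increasing[of 1 d ?A] by simp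
  have "2 * cmod \<delta> * radius r N \<le> 2 * cmod \<delta> * ?A ^ d"
    using radius_mono[OF r, of N] A1 by (intro mult_left_mono) auto
  also have "\<dots> \<le> 2 ^ d * cmod \<delta> * ?A ^ d"
    using ge degree_ge_2 power_increasing[of 1 d "2::real"] by (intro mult_right_mono) auto
  finally have "coeff_sum * (2 * ?A) ^ d + 2 * cmod \<delta> * radius r N \<le> ((coeff_sum + cmod \<delta>) * 2 ^ d) * ?A ^ d"
    by (simp add: power_mult_distrib algebra_simps)
  also have "\<dots> < Q * ?A ^ d"
    using Q_ge ge by (intro mult_strict_right_mono) auto
  also have "\<dots> \<le> radius r (Suc (Suc N))"
  proof -
    have "Q * Q \<le> Q ^ d"
      using Q_ge(2) degree_ge_2 power_increasing[of 2 d Q] by (simp add: power2_eq_square)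
    then have "(Q * Q) * ?A ^ d \<le> Q ^ d * ?A ^ d"
      using radius_pos[of r "Suc N"] by (intro mult_right_mono) auto
    also have "\<dots> = exp (d ^ Suc N * r) ^ d"
      using Q by (simp add: power_mult_distrib[symmetric] radius_def)
    also have "\<dots> = exp (d ^ Suc (Suc N) * r)"
      by (simp add: exp_of_nat_mult[symmetric] mult_ac)
    finally show ?thesis using Q by (simp add: radius_def pos_le_divide_eq mult_ac)
  qed
  finally show ?thesis by simp
qed

section \<open>Deforming one polydisc preimage into the next\<close>

lemma c2_automorphism_stage:
  assumes "0 \<le> s" "s \<le> 1"
  shows "c2_automorphism (stage r N s)"
proof -
  have "c2_automorphism (\<lambda>x. (fst x / complex_of_real (fst_radius r N s),
      (\<delta> * snd x + complex_of_real s * poly p (fst x)) / complex_of_real (snd_radius r N s)))"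
    using fst_radius_pos[OF assms(1), of r N] snd_radius_pos[OF assms, of r N] delta_nonzero
    by (intro c2_automorphism_shear) auto
  from c2_automorphism_comp[OF c2_automorphism_iterate this]
  show ?thesis unfolding stage_def Let_def .
qed

lemma gauge2_stage:
  assumes "0 \<le> s" "s \<le> 1" and "y = (H ^^ Suc N) x"
  shows "gauge2 (stage r N s x) =
    max (cmod (fst y) / fst_radius r N s) (cmod (\<delta> * snd y + complex_of_real s * poly p (fst y)) / snd_radius r N s)"
  using fst_radius_pos[OF assms(1), of r N] snd_radius_pos[OF assms(1,2), of r N]
  by (simp add: stage_def gauge2_def norm_divide assms(3) Let_def del: funpow.simps)

text \<open>At \<open>s = 1\<close> the sheared second coordinate is the first coordinate of
  \<open>H y\<close>, and \<open>fst y\<close> is its second, so the two entries of the maximum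
  merely swap.\<close>

lemma gauge2_stage_match: "gauge2 (stage r N 1 x) = gauge2 (stage r (Suc N) 0 x)"
proof -
  define y where "y = (H ^^ Suc N) x"
  have "gauge2 (stage r N 1 x) = max (cmod (fst y) / (2 * radius r (Suc N)))
      (cmod (\<delta> * snd y + poly p (fst y)) / radius r (Suc (Suc N)))"
    by (subst gauge2_stage[OF _ _ y_def]) (auto simp: fst_radius_def snd_radius_def)
  moreover have "gauge2 (stage r (Suc N) 0 x) = max (cmod (fst (H y)) / radius r (Suc (Suc N)))
      (cmod (\<delta> * snd (H y)) / (2 * cmod \<delta> * radius r (Suc N)))"
    by (subst gauge2_stage[of _ "H y"]) (auto simp: fst_radius_def snd_radius_def y_def)
  ultimately show ?thesis
    using delta_nonzero by (simp add: norm_mult add.commute max.commute)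
qed

text \<open>Passing from \<open>s\<close> to \<open>s'\<close> moves the sheared coordinate by
  \<open>(s' - s) * cmod (p z)\<close>, while its radius grows by \<open>s' - s\<close> times a
  slope exceeding this modulus.\<close>

lemma gauge2_stage_mono:
  assumes r: "r > 0" and ge: "radius r (Suc N) \<ge> 1"
    and s: "0 \<le> s" "s < s'" "s' \<le> 1" and le: "gauge2 (stage r N s x) \<le> 1"
  shows "gauge2 (stage r N s' x) < 1"
proof -
  define y where "y = (H ^^ Suc N) x"
  let ?A = "radius r (Suc N)"
  have y1: "cmod (fst y) \<le> fst_radius r N s"
    and y2: "cmod (\<delta> * snd y + complex_of_real s * poly p (fst y)) \<le> snd_radius r N s"
    using le fst_radius_pos[of s r N] snd_radius_pos[of s r N] s
    by (auto simp: gauge2_stage[OF _ _ y_def] divide_le_eq_1)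
  have "fst_radius r N s < fst_radius r N s'" using s radius_pos by (simp add: fst_radius_def)
  then have 1: "cmod (fst y) < fst_radius r N s'" using y1 by simp
  have "fst_radius r N s \<le> 2 * ?A" unfolding fst_radius_def using s radius_pos[of r "Suc N"] by (intro mult_right_mono) auto
  then have "cmod (poly p (fst y)) \<le> coeff_sum * (2 * ?A) ^ d"
    using ge y1 by (intro cmod_poly_le) auto
  also have "\<dots> < radius r (Suc (Suc N)) - 2 * cmod \<delta> * radius r N" by (rule radius_growth[OF r ge])
  finally have p: "(s' - s) * cmod (poly p (fst y)) < (s' - s) * (radius r (Suc (Suc N)) - 2 * cmod \<delta> * radius r N)"
    using s by simp
  have "\<delta> * snd y + complex_of_real s' * poly p (fst y)
      = (\<delta> * snd y + complex_of_real s * poly p (fst y)) + complex_of_real (s' - s) * poly p (fst y)"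
    by (simp add: algebra_simps)
  then have "cmod (\<delta> * snd y + complex_of_real s' * poly p (fst y))
      \<le> cmod (\<delta> * snd y + complex_of_real s * poly p (fst y)) + (s' - s) * cmod (poly p (fst y))"
    using s norm_triangle_ineq[of "\<delta> * snd y + complex_of_real s * poly p (fst y)" "complex_of_real (s' - s) * poly p (fst y)"]
    by (simp only: norm_mult norm_of_real)
  also have "\<dots> < snd_radius r N s + (s' - s) * (radius r (Suc (Suc N)) - 2 * cmod \<delta> * radius r N)"
    using y2 p by linarith
  also have "\<dots> = snd_radius r N s'" by (simp add: snd_radius_def algebra_simps)
  finally have 2: "cmod (\<delta> * snd y + complex_of_real s' * poly p (fst y)) < snd_radius r N s'" .
  show ?thesis
    using 1 2 fst_radius_pos[of s' r N] snd_radius_pos[of s' r N] s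
    by (subst gauge2_stage[OF _ _ y_def]) (auto simp: divide_less_eq_1)
qed

lemma continuous_gauge2_stage: "continuous_on {0..1} (\<lambda>s. gauge2 (stage r N s x))"
proof -
  define y where "y = (H ^^ Suc N) x"
  have "fst_radius r N s \<noteq> 0" "snd_radius r N s \<noteq> 0" if "s \<in> {0..1}" for s
    using that fst_radius_pos[of s r N] snd_radius_pos[of s r N] by auto
  moreover have "continuous_on {0..1} (fst_radius r N)" "continuous_on {0..1} (snd_radius r N)"
    unfolding fst_radius_def snd_radius_def by (intro continuous_intros)+
  ultimately have "continuous_on {0..1} (\<lambda>s. max (cmod (fst y) / fst_radius r N s)
      (cmod (\<delta> * snd y + complex_of_real s * poly p (fst y)) / snd_radius r N s))"
    by (intro continuous_intros) auto
  then show ?thesis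
    by (rule continuous_on_eq) (subst gauge2_stage[OF _ _ y_def], auto)
qed

theorem loewner_short_C2_G_less:
  assumes r: "r > 0"
  shows "loewner_short_C2 {x. G x < r}"
proof -
  obtain N0 where N0: "\<And>n. n \<ge> N0 \<Longrightarrow> Q < exp (real d ^ n * r)"
    using exp_power_unbounded[OF degree_ge_2 r] by blast
  have ge: "radius r N \<ge> 1" if "N \<ge> N0" for N
    using N0[OF that] Q_ge by (simp add: radius_def)
  \<comment> \<open>The integer part of the time selects the stage and the fractional part the
    shear; starting at \<open>N0\<close> makes all radii at least 1.\<close>
  define T where "T = (\<lambda>t. stage r (N0 + nat \<lfloor>t\<rfloor>) (frac t))"
  \<comment> \<open>The right endpoint is included although \<open>T\<close> has already switched to
    the next stage there; the matching of consecutive stages makes this possible.\<close>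
  have T: "gauge2 (T t x) = gauge2 (stage r (N0 + n) (t - n) x)" if "real n \<le> t" "t \<le> real n + 1" for t n x
  proof (cases "t = real n + 1")
    case True
    then have fl: "\<lfloor>t\<rfloor> = int (Suc n)" by simp
    have "nat \<lfloor>t\<rfloor> = Suc n" unfolding fl by (rule nat_int)
    moreover have "frac t = 0" unfolding frac_def fl by (simp add: True)
    ultimately have "T t = stage r (Suc (N0 + n)) 0" unfolding T_def by (simp only: add_Suc_right)
    then show ?thesis using gauge2_stage_match[of r "N0 + n" x] True by simp
  next
    case False
    then have fl: "\<lfloor>t\<rfloor> = int n" using that by (intro floor_unique) auto
    show ?thesis unfolding T_def frac_def fl by simp
  qed
  have step: "gauge2 (T s x) < 1"
    if "real n \<le> t" "t < s" "s \<le> real n + 1" "gauge2 (T t x) \<le> 1" for n t s x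
    using that T[of n t x] T[of n s x] gauge2_stage_mono[OF r ge, of "N0 + n" "t - n" "s - n" x] by simp
  \<comment> \<open>An interval crossing the integer \<open>k\<close> is split there, since
    \<open>step\<close> works within one stage.\<close>
  have mono_nat: "0 \<le> t \<Longrightarrow> t < s \<Longrightarrow> s \<le> real k \<Longrightarrow> gauge2 (T t x) \<le> 1 \<Longrightarrow> gauge2 (T s x) < 1" for k t s x
  proof (induction k arbitrary: t s)
    case 0
    then show ?case by simp
  next
    case (Suc k)
    consider "s \<le> real k" | "real k \<le> t" | "t < real k" "real k < s" by linarith
    then show ?case
    proof cases
      case 1
      then show ?thesis using Suc by blast
    next
      case 2
      then show ?thesis using Suc.prems step[of k t s x] by simp
    next
      case 3
      then have "gauge2 (T (real k) x) < 1" using Suc by blast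
      then show ?thesis using 3 Suc.prems step[of k "real k" s x] by simp
    qed
  qed
  have mono: "gauge2 (T s x) < 1" if "0 \<le> t" "t < s" "gauge2 (T t x) \<le> 1" for t s x
  proof -
    obtain k :: nat where "s \<le> k" using real_arch_simple by blast
    then show ?thesis using mono_nat that by blast
  qed
  have cont: "continuous_on {0..real n} (\<lambda>t. gauge2 (T t x))" for n x
  proof (induction n)
    case 0
    then show ?case by simp
  next
    case (Suc n)
    have "continuous_on {real n..real n + 1} (\<lambda>t. gauge2 (stage r (N0 + n) (t - n) x))"
      by (rule continuous_on_compose2[OF continuous_gauge2_stage]) (auto intro!: continuous_intros)
    then have "continuous_on {real n..real n + 1} (\<lambda>t. gauge2 (T t x))"
      by (rule continuous_on_eq) (rule T[symmetric], auto)
    with Suc have "continuous_on ({0..real n} \<union> {real n..real n + 1}) (\<lambda>t. gauge2 (T t x))"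
      by (intro continuous_on_closed_Un) auto
    moreover have "{0..real n} \<union> {real n..real n + 1} = {0..real (Suc n)}" by auto
    ultimately show ?case by simp
  qed
  have "x \<in> {x. G x < r}" if "t \<ge> 0" "gauge2 (T t x) < 1" for t x
  proof -
    obtain n :: nat where "t < n" using reals_Archimedean2 by blast
    \<comment> \<open>Moving on to an integer time gives \<open>s = 0\<close>, where the domain is a
      plain polydisc preimage that fits into a ball preimage.\<close>
    then have "gauge2 (T n x) < 1" using mono[of t n x] that by simp
    then have *: "gauge2 (stage r (N0 + n) 0 x) < 1" using T[of n n x] by simp
    let ?N = "N0 + n"
    define y where "y = (H ^^ Suc ?N) x"
    have "cmod (fst y) / fst_radius r ?N 0 < 1" "cmod \<delta> * cmod (snd y) / snd_radius r ?N 0 < 1"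
      using * by (simp_all add: gauge2_stage[OF _ _ y_def] norm_mult)
    then have "cmod (fst y) < fst_radius r ?N 0" "cmod \<delta> * cmod (snd y) < snd_radius r ?N 0"
      using fst_radius_pos[of 0 r ?N] snd_radius_pos[of 0 r ?N] by (simp_all add: divide_less_eq_1)
    then have "cmod (fst y) < radius r (Suc ?N)" "cmod (snd y) < 2 * radius r ?N"
      using delta_nonzero by (simp_all add: fst_radius_def snd_radius_def mult.left_commute)
    then have "norm y < 3 * radius r (Suc ?N)"
      using norm_c2_le[of y] radius_mono[OF r, of ?N] by linarith
    also have "\<dots> \<le> exp (d ^ Suc ?N * r) / K"
    proof -
      have "exp (d ^ Suc ?N * r) * (3 * K) \<le> exp (d ^ Suc ?N * r) * Q"
        using Q_ge(1) by (intro mult_left_mono) auto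
      then show ?thesis using Q_ge(2) K_ge_1 by (simp add: radius_def field_simps)
    qed
    finally have "norm y < exp (d ^ Suc ?N * r) / K" .
    moreover have "1 < exp (d ^ Suc ?N * r) / K"
      using N0[of "Suc ?N"] Q_ge K_ge_1 by (simp add: pos_less_divide_eq)
    ultimately have "green_approx (Suc ?N) x < r"
      unfolding green_approx_less_iff orbit_norm_def y_def by simp
    then show ?thesis unfolding mem_Collect_eq G_less_iff by (rule exI)
  qed
  moreover have "\<exists>t\<ge>0. gauge2 (T t x) < 1" if Gx: "G x < r" for x
  proof -
    obtain s where s: "G x < s" "s < r" using dense[OF Gx] by blast
    obtain M where M: "green_approx M x < s" using s(1) unfolding G_less_iff by blast
    obtain N' where N': "\<And>n. n \<ge> N' \<Longrightarrow> Q < exp (real d ^ n * (r - s))"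
      using exp_power_unbounded[OF degree_ge_2, of "r - s"] s by auto
    \<comment> \<open>This is used for two consecutive iterates, because the second coordinate of
      \<open>(H ^^ Suc n) x\<close> is the first coordinate of \<open>(H ^^ n) x\<close>.\<close>
    have lt: "norm ((H ^^ n) x) < radius r n" if "n \<ge> M" "n \<ge> N'" for n
    proof -
      have "green_approx n x < s" using decseqD[OF green_approx_decseq that(1), of x] M by simp
      then have "orbit_norm n x < exp (d ^ n * s) / K" unfolding green_approx_less_iff .
      also have "\<dots> \<le> exp (d ^ n * s)" using K_ge_1 by (simp add: pos_divide_le_eq)
      also have "\<dots> \<le> radius r n"
      proof -
        have "exp (d ^ n * s) * Q \<le> exp (d ^ n * s) * exp (d ^ n * (r - s))"
          using N'[OF that(2)] by (intro mult_left_mono) auto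
        also have "\<dots> = exp (d ^ n * r)" by (simp add: exp_add[symmetric] algebra_simps)
        finally show ?thesis using Q_ge by (simp add: radius_def pos_le_divide_eq)
      qed
      finally show ?thesis by (simp add: orbit_norm_def)
    qed
    define n where "n = max M N'"
    let ?N = "N0 + n"
    define y where "y = (H ^^ Suc ?N) x"
    have "norm y < radius r (Suc ?N)" unfolding y_def by (rule lt) (auto simp: n_def)
    then have "cmod (fst y) < fst_radius r ?N 0" using cmod_fst_le[of y] by (simp add: fst_radius_def)
    moreover have "cmod (\<delta> * snd y) < snd_radius r ?N 0"
    proof -
      have "norm ((H ^^ ?N) x) < radius r ?N" by (rule lt) (auto simp: n_def)
      then have "cmod (snd y) < radius r ?N" using cmod_fst_le[of "(H ^^ ?N) x"] by (simp add: y_def)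
      then have "cmod (snd y) < 2 * radius r ?N" using radius_pos[of r ?N] by linarith
      then show ?thesis using delta_nonzero by (simp add: snd_radius_def norm_mult mult.left_commute)
    qed
    ultimately have "gauge2 (stage r ?N 0 x) < 1"
      using fst_radius_pos[of 0 r ?N] snd_radius_pos[of 0 r ?N] by (simp add: gauge2_stage[OF _ _ y_def] divide_less_eq_1)
    then show ?thesis using T[of n n x] by (intro exI[of _ "real n"]) simp
  qed
  ultimately have union: "(\<Union>t\<in>{0..}. {x. gauge2 (T t x) < 1}) = {x. G x < r}"
    unfolding atLeast_def by blast
  show ?thesis
  proof (rule loewner_short_C2I[OF short_C2_G_less[OF r] union _ mono cont])
    show "c2_automorphism (T t)" if "t \<ge> 0" for t
      unfolding T_def using frac_lt_1[of t] by (intro c2_automorphism_stage) auto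
  qed
qed

end

theorem theorem1p5:
  fixes p :: "complex poly" and \<delta> :: complex and r :: real
  assumes "degree p \<ge> 2" and "\<delta> \<noteq> 0" and "r > 0"
  shows "loewner_short_C2 {x. green_plus (henon p \<delta>) (degree p) x < r}"
proof -
  interpret henon_map p \<delta> using assms by unfold_locales
  show ?thesis by (rule loewner_short_C2_G_less[OF assms(3)])
qed

end
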